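(* Let $r>0$, $r\ne1$. Let $H=H(x,y)$ be a real-valued $C^2$ solution of the Euler–Lagrange equation of the five-vertex model with corner weight $r$ (for instance a limit shape), with gradient $(s,t)=(H_x,H_y)$ in the interior of $\mathcal N^*$ if $r<1$, respectively in the interior of $\mathcal N$ if $r>1$, and let $w,z$ be the complex functions of $(x,y)$ associated to $(s,t)$. Then, locally where $w$ is a coordinate (i.e. where $(x,y)\mapsto w$ is invertible), $$(w-1)x+(z-1)y+H+f(w)=0,$$ where $f$ is an analytic function depending only on the boundary conditions (that is, only on the solution $H$).
   Context: $\arg$ is the principal argument; $\mathrm{Li}(z)=-\int_0^z\log(1-\zeta)\,d\zeta/\zeta$; $B(z)=\frac1\pi(\arg z\log|1-z|+\operatorname{Im}\mathrm{Li}(z))$. $\mathcal N$ is the triangle with vertices $(0,0),(1,0),(0,1)$; for $r<1$ the interior of $\mathcal N^*$ is $\{s>0,\ t>0,\ \frac{1-r^2}{r^2}st+s+t-1<0\}$. For $(s,t)$ in the interior of $\mathcal N^*$ (if $r<1$) or of $\mathcal N$ (if $r>1$) there is a unique $u$ in the open upper half plane such that, with $\theta=\pi-\arg(u-1)+\arg(u-r^2)$, $$s\theta=\pi-\arg(u-1),\qquad t\theta=\arg(u-r^2)-\arg u,\qquad(1-s-t)\theta=\arg u.$$ If $r<1$: $w=\frac{1-\overline u}{1-r^2}$, $z=\frac{1-r^2/\overline u}{1-r^2}$, and the surface tension $\sigma(s,t)$ has gradient $\sigma_s=X:=-\log(1-r^2)-B(\overline z)$, $\sigma_t=Y:=-\log(1-r^2)-B(w)$.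 If $r>1$: $w=\frac{u-1}{r^2-1}$, $z=\frac{r^2/u-1}{r^2-1}$, and $\sigma_s=X:=-\log(r^2-1)+B(\overline z)-\log|z(1-z)|$, $\sigma_t=Y:=-\log(r^2-1)+B(w)-\log|w(1-w)|$. In both cases $w$ lies in the upper and $z$ in the lower half plane, and $1-w-z+(1-r^2)wz=0$. The Euler–Lagrange equation is $\operatorname{div}_{x,y}(\nabla\sigma(\nabla H))=0$, i.e. $X_x+Y_y=0$ with $(s,t)=(H_x,H_y)$. *)

theory Defs
  imports "HOL-Complex_Analysis.Complex_Analysis"
begin

text \<open>Integration is along the straight segment from 0, which avoids the branch cut of
  log (1 - \<zeta>) when z is in the open upper half plane. The singularity of the integrand at 0
  is removable, so its conventional value there does not matter.\<close>

definition dilog :: "complex \<Rightarrow> complex" where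
  "dilog z = - contour_integral (linepath 0 z) (\<lambda>\<zeta>. Ln (1 - \<zeta>) / \<zeta>)"

definition B_fun :: "complex \<Rightarrow> real" where
  "B_fun z = (Arg z * ln (cmod (1 - z)) + Im (dilog z)) / pi"

definition newton_N :: "(real \<times> real) set" where
  "newton_N = convex hull {(0,0), (1,0), (0,1)}"

text \<open>The open region of slopes for corner weight r: the interior of N* if r < 1 and the
  interior of the triangle N if r > 1.\<close>

definition slope_region :: "real \<Rightarrow> (real \<times> real) set" where
  "slope_region r =
    (if r < 1 then {(s, t). s > 0 \<and> t > 0 \<and> (1 - r\<^sup>2) / r\<^sup>2 * s * t + s + t - 1 < 0}
     else interior newton_N)"

definition theta_angle :: "real \<Rightarrow> complex \<Rightarrow> real" where
  "theta_angle r u = pi - Arg (u - 1) + Arg (u - of_real (r\<^sup>2))"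

definition u_of :: "real \<Rightarrow> real \<Rightarrow> real \<Rightarrow> complex" where
  "u_of r s t = (THE u. Im u > 0
      \<and> s * theta_angle r u = pi - Arg (u - 1)
      \<and> t * theta_angle r u = Arg (u - of_real (r\<^sup>2)) - Arg u
      \<and> (1 - s - t) * theta_angle r u = Arg u)"

definition w_of :: "real \<Rightarrow> real \<Rightarrow> real \<Rightarrow> complex" where
  "w_of r s t = (let u = u_of r s t in
      if r < 1 then (1 - cnj u) / of_real (1 - r\<^sup>2)
      else (u - 1) / of_real (r\<^sup>2 - 1))"

definition z_of :: "real \<Rightarrow> real \<Rightarrow> real \<Rightarrow> complex" where
  "z_of r s t = (let u = u_of r s t in
      if r < 1 then (1 - of_real (r\<^sup>2) / cnj u) / of_real (1 - r\<^sup>2)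
      else (of_real (r\<^sup>2) / u - 1) / of_real (r\<^sup>2 - 1))"

text \<open>The two components X, Y of the gradient of the surface tension; the surface tension itself
  enters the Euler-Lagrange equation only through them.\<close>

definition sigma_s :: "real \<Rightarrow> real \<Rightarrow> real \<Rightarrow> real" where
  "sigma_s r s t = (let z = z_of r s t in
      if r < 1 then - ln (1 - r\<^sup>2) - B_fun (cnj z)
      else - ln (r\<^sup>2 - 1) + B_fun (cnj z) - ln (cmod (z * (1 - z))))"

definition sigma_t :: "real \<Rightarrow> real \<Rightarrow> real \<Rightarrow> real" where
  "sigma_t r s t = (let w = w_of r s t in
      if r < 1 then - ln (1 - r\<^sup>2) - B_fun w
      else - ln (r\<^sup>2 - 1) + B_fun w - ln (cmod (w * (1 - w))))"

definition partial_x :: "(real \<times> real \<Rightarrow> real) \<Rightarrow> real \<times> real \<Rightarrow> real" where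
  "partial_x f = (\<lambda>(x, y). deriv (\<lambda>x'. f (x', y)) x)"

definition partial_y :: "(real \<times> real \<Rightarrow> real) \<Rightarrow> real \<times> real \<Rightarrow> real" where
  "partial_y f = (\<lambda>(x, y). deriv (\<lambda>y'. f (x, y')) y)"

definition C1_on :: "(real \<times> real) set \<Rightarrow> (real \<times> real \<Rightarrow> real) \<Rightarrow> bool" where
  "C1_on D f \<longleftrightarrow> (\<forall>p\<in>D. f differentiable (at p))
     \<and> continuous_on D (partial_x f) \<and> continuous_on D (partial_y f)"

definition C2_on :: "(real \<times> real) set \<Rightarrow> (real \<times> real \<Rightarrow> real) \<Rightarrow> bool" where
  "C2_on D f \<longleftrightarrow> C1_on D f \<and> C1_on D (partial_x f) \<and> C1_on D (partial_y f)"

definition euler_lagrange_on :: "real \<Rightarrow> (real \<times> real) set \<Rightarrow> (real \<times> real \<Rightarrow> real) \<Rightarrow> bool" where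
  "euler_lagrange_on r D H \<longleftrightarrow>
    (\<forall>(x, y)\<in>D. \<exists>a b.
       ((\<lambda>x'. sigma_s r (partial_x H (x', y)) (partial_y H (x', y))) has_real_derivative a) (at x)
     \<and> ((\<lambda>y'. sigma_t r (partial_x H (x, y')) (partial_y H (x, y'))) has_real_derivative b) (at y)
     \<and> a + b = 0)"

definition w_field :: "real \<Rightarrow> (real \<times> real \<Rightarrow> real) \<Rightarrow> real \<times> real \<Rightarrow> complex" where
  "w_field r H p = w_of r (partial_x H p) (partial_y H p)"

definition z_field :: "real \<Rightarrow> (real \<times> real \<Rightarrow> real) \<Rightarrow> real \<times> real \<Rightarrow> complex" where
  "z_field r H p = z_of r (partial_x H p) (partial_y H p)"

text \<open>A coordinate is a diffeomorphism onto its image, hence the invertible (real-linear)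
  derivative in addition to injectivity.\<close>

definition coordinate_on :: "(real \<times> real) set \<Rightarrow> (real \<times> real \<Rightarrow> complex) \<Rightarrow> bool" where
  "coordinate_on U \<phi> \<longleftrightarrow> inj_on \<phi> U
     \<and> (\<forall>p\<in>U. \<exists>\<phi>'. (\<phi> has_derivative \<phi>') (at p) \<and> bij \<phi>')"

end

theory Submission
  imports Defs
begin

text \<open>
  Put \<open>F = (w - 1) x + (z - 1) y + H\<close>. The claim is that \<open>F\<close> is an analytic function of \<open>w\<close>, and
  where \<open>w\<close> is a coordinate this says that the real differential of \<open>F\<close> is a complex multiple of
  that of \<open>w\<close> (\<open>holomorphic_factor\<close>). Since \<open>z\<close> is a Moebius function of \<open>w\<close> and
  \<open>dH = s dx + t dy\<close>,
  \<open>dF = (x + (dz/dw) y) dw - ((1 - s - w) dx + (1 - t - z) dy)\<close>, so that everything rests on the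
  complex Burgers equation \<open>(1 - s - w) w_y = (1 - t - z) w_x\<close> (\<open>burgers_equation\<close>).

  Its real and imaginary parts, after division by \<open>w (1 - w)\<close>, are the two equations that \<open>H\<close>
  satisfies. Write \<open>v\<close> for \<open>w\<close> or for the conjugate of \<open>z\<close>, and \<open>\<sigma>\<close> for the corresponding slope
  \<open>s\<close> or \<open>t\<close>. In terms of the angle \<open>\<theta>\<close>, both \<open>Arg v\<close> and \<open>Arg (1 - v)\<close> are affine in
  \<open>\<sigma> \<theta>\<close> and \<open>\<theta>\<close> (\<open>slope_angles_w_z\<close>). The form
  \<open>\<eta> = (1 - \<sigma>) dlog v + \<sigma> dlog (1 - v)\<close> then has
  imaginary part \<open>\<plusminus> \<theta> d\<sigma>\<close> (\<open>slope_angles_Im\<close>), while its real part times \<open>- \<theta> / \<pi>\<close> is the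
  differential of the component of the gradient of the surface tension
  (\<open>slope_potential_has_derivative\<close>), because
  \<open>\<pi> dB(v) = Arg v dlog |1 - v| - Arg (1 - v) dlog |v|\<close>; for \<open>r > 1\<close> the
  logarithmic term of the surface tension absorbs the shift of these arguments by \<open>\<pi>\<close>. Hence the
  real part of the Burgers equation is the Euler-Lagrange equation without its factor \<open>\<theta> / \<pi>\<close>, and
  the imaginary part is the symmetry \<open>s_y = t_x\<close> of the second derivatives of \<open>H\<close>.

  To speak about \<open>Arg v\<close> it must be known that the equations for \<open>u\<close> have exactly one solution. By
  the law of sines they reduce to
  \<open>sin (s \<theta>) sin (t \<theta>) = r\<^sup>2 sin ((1 - s) \<theta>) sin ((1 - t) \<theta>)\<close>. The quotient of the two sides is
  increasing in \<open>\<theta>\<close>, and its limit at 0 is below 1 on the slope region. This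
  treatment is the same for \<open>r < 1\<close> and \<open>r > 1\<close>.
\<close>

section \<open>The equation for the angle \<theta>\<close>

text \<open>This is the numerator of the derivative of \<open>sin (a x) / sin (b x)\<close>. It vanishes at 0, and its own
  derivative is \<open>(b\<^sup>2 - a\<^sup>2) sin (a x) sin (b x) > 0\<close>.\<close>

lemma sin_cross_pos:
  fixes a b x :: real
  assumes "0 < a" "a < b" "0 < x" "b * x < pi"
  shows "0 < a * cos (a * x) * sin (b * x) - b * sin (a * x) * cos (b * x)"
proof -
  define q where "q = (\<lambda>y. a * cos (a * y) * sin (b * y) - b * sin (a * y) * cos (b * y))"
  have "q 0 < q x"
  proof (rule DERIV_pos_imp_increasing_open[where f = q])
    show "0 < x" by fact
    fix y assume y: "0 < y" "y < x"
    have d: "(q has_real_derivative (b\<^sup>2 - a\<^sup>2) * (sin (a * y) * sin (b * y))) (at y)"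
      unfolding q_def
      by (auto intro!: derivative_eq_intros simp: algebra_simps power2_eq_square)
    have "b * y < b * x" "a * y < b * y" "0 < a * y" "0 < b * y"
      using assms y by auto
    moreover from this have "b * y < pi" "a * y < pi" using assms by linarith+
    ultimately have "sin (a * y) > 0" "sin (b * y) > 0"
      by (auto intro!: sin_gt_zero)
    moreover have "b\<^sup>2 - a\<^sup>2 > 0"
      using assms by (simp add: power_strict_mono)
    ultimately show "\<exists>d. (q has_real_derivative d) (at y) \<and> 0 < d"
      using d by (meson mult_pos_pos)
  next
    show "continuous_on {0..x} q"
      unfolding q_def by (intro continuous_intros)
  qed
  thus ?thesis by (simp add: q_def)
qed

lemma sin_quotient_strict_mono:
  fixes a b x y :: real
  assumes "0 < a" "a < b" "0 < x" "x < y" "b * y < pi"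
  shows "sin (a * x) / sin (b * x) < sin (a * y) / sin (b * y)"
proof (rule DERIV_pos_imp_increasing_open[where f = "\<lambda>x. sin (a * x) / sin (b * x)"])
  show "x < y" by fact
  have pos: "b * z < pi \<and> sin (b * z) > 0" if "x \<le> z" "z \<le> y" for z
  proof -
    have "b * z \<le> b * y" "0 < b * z" using assms that by auto
    hence "b * z < pi" using assms by linarith
    with \<open>0 < b * z\<close> show ?thesis by (auto intro!: sin_gt_zero)
  qed
  fix z assume z: "x < z" "z < y"
  have "sin (b * z) > 0" using pos[of z] z by auto
  hence "((\<lambda>x. sin (a * x) / sin (b * x)) has_real_derivative
      (a * cos (a * z) * sin (b * z) - b * sin (a * z) * cos (b * z)) / (sin (b * z))\<^sup>2) (at z)"
    by (auto intro!: derivative_eq_intros simp: power2_eq_square)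
  moreover have "(a * cos (a * z) * sin (b * z) - b * sin (a * z) * cos (b * z)) / (sin (b * z))\<^sup>2 > 0"
    using sin_cross_pos[of a b z] assms z pos[of z] by auto
  ultimately show "\<exists>d. ((\<lambda>x. sin (a * x) / sin (b * x)) has_real_derivative d) (at z) \<and> 0 < d"
    by blast
next
  show "continuous_on {x..y} (\<lambda>x. sin (a * x) / sin (b * x))"
  proof (intro continuous_intros ballI)
    fix z assume "z \<in> {x..y}"
    hence "b * z \<le> b * y" "0 < b * z" using assms by auto
    hence "0 < b * z" "b * z < pi" using assms by linarith+
    thus "sin (b * z) \<noteq> 0" using sin_gt_zero[of "b * z"] assms by auto
  qed
qed

text \<open>The condition on \<open>\<theta>\<close> that remains after \<open>u\<close> has been eliminated from the equations that define it,
  with \<open>q\<close> in place of \<open>r\<^sup>2\<close>. The upper bounds keep all the sines positive.\<close>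

definition slope_angle_eq :: "real \<Rightarrow> real \<Rightarrow> real \<Rightarrow> real \<Rightarrow> bool" where
  "slope_angle_eq q s t \<theta> \<longleftrightarrow> 0 < \<theta> \<and> (1 - s) * \<theta> < pi \<and> (1 - t) * \<theta> < pi \<and>
     sin (s * \<theta>) * sin (t * \<theta>) = q * sin ((1 - s) * \<theta>) * sin ((1 - t) * \<theta>)"

text \<open>Divided by the right-hand sines, the equation says that the product of
  \<open>sin (t \<theta>) / sin ((1 - s) \<theta>)\<close> and \<open>sin (s \<theta>) / sin ((1 - t) \<theta>)\<close> is \<open>q\<close>. Both factors are strictly
  increasing since \<open>t < 1 - s\<close> and \<open>s < 1 - t\<close>.\<close>

lemma slope_angle_eq_unique:
  assumes st: "0 < s" "0 < t" "s + t < 1"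
    and "slope_angle_eq q s t x" "slope_angle_eq q s t y"
  shows "x = y"
proof -
  have False
    if x: "slope_angle_eq q s t x" and y: "slope_angle_eq q s t y" and less: "x < y" for x y
  proof -
    have pos: "0 < sin ((1 - s) * z)" "0 < sin ((1 - t) * z)" "0 < sin (s * z)" "0 < sin (t * z)"
      "sin (t * z) / sin ((1 - s) * z) * (sin (s * z) / sin ((1 - t) * z)) = q"
      if "slope_angle_eq q s t z" for z
    proof -
      have z: "0 < z" "(1 - s) * z < pi" "(1 - t) * z < pi"
        "sin (s * z) * sin (t * z) = q * sin ((1 - s) * z) * sin ((1 - t) * z)"
        using that by (auto simp: slope_angle_eq_def)
      have "s * z < (1 - t) * z" "t * z < (1 - s) * z"
        using st z(1) by (auto intro!: mult_strict_right_mono)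
      hence "s * z < pi" "t * z < pi" using z by linarith+
      thus *: "0 < sin ((1 - s) * z)" "0 < sin ((1 - t) * z)" "0 < sin (s * z)" "0 < sin (t * z)"
        using st z by (auto intro!: sin_gt_zero mult_pos_pos)
      show "sin (t * z) / sin ((1 - s) * z) * (sin (s * z) / sin ((1 - t) * z)) = q"
        using z(4) * by (simp add: field_simps)
    qed
    have "sin (t * x) / sin ((1 - s) * x) < sin (t * y) / sin ((1 - s) * y)"
         "sin (s * x) / sin ((1 - t) * x) < sin (s * y) / sin ((1 - t) * y)"
      using st x y less by (auto intro!: sin_quotient_strict_mono simp: slope_angle_eq_def)
    hence "sin (t * x) / sin ((1 - s) * x) * (sin (s * x) / sin ((1 - t) * x))
        < sin (t * y) / sin ((1 - s) * y) * (sin (s * y) / sin ((1 - t) * y))"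
      using pos(1-4)[OF x] pos(1-4)[OF y] by (intro mult_strict_mono) auto
    thus False by (simp only: pos(5)[OF x] pos(5)[OF y])
  qed
  from this[of x y] this[of y x] show ?thesis using assms by fastforce
qed

text \<open>Intermediate value theorem. At the upper end \<open>T\<close> of the admissible angles one of the sines on
  the right vanishes. Near 0 the difference of the two sides is
  \<open>\<theta>\<^sup>2 (s t - q (1 - s) (1 - t))\<close> to leading order, and the hypothesis makes this negative.\<close>

lemma slope_angle_eq_ex:
  assumes st: "0 < s" "0 < t" "s + t < 1" and q: "s * t < q * (1 - s) * (1 - t)"
  shows "\<exists>\<theta>. slope_angle_eq q s t \<theta>"
proof -
  define k where "k = (\<lambda>x. sin (s * x) * sin (t * x) - q * sin ((1 - s) * x) * sin ((1 - t) * x))"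
  define T where "T = pi / max (1 - s) (1 - t)"
  have mx: "max (1 - s) (1 - t) > 0" using st by auto
  have T: "T > 0" using mx by (simp add: T_def)
  have kT: "k T > 0"
  proof -
    have "max (1 - s) (1 - t) * T = pi" using mx by (simp add: T_def)
    hence "sin ((1 - s) * T) = 0 \<or> sin ((1 - t) * T) = 0"
      by (metis max_def sin_pi)
    moreover have "s * T < max (1 - s) (1 - t) * T" "t * T < max (1 - s) (1 - t) * T"
      using st T by (auto intro!: mult_strict_right_mono)
    hence "sin (s * T) > 0" "sin (t * T) > 0"
      using st T \<open>max (1 - s) (1 - t) * T = pi\<close> by (auto intro!: sin_gt_zero)
    ultimately show ?thesis by (auto simp: k_def)
  qed
  have sinc: "((\<lambda>x. sin (a * x) / x) \<longlongrightarrow> a) (at_right 0)" for a :: real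
  proof -
    have "((\<lambda>x. sin (a * x)) has_real_derivative a) (at 0)"
      by (auto intro!: derivative_eq_intros)
    thus ?thesis
      by (auto simp: has_field_derivative_iff intro: filterlim_at_split[THEN iffD1, THEN conjunct2])
  qed
  have "((\<lambda>x. sin (s * x) / x * (sin (t * x) / x)
      - q * (sin ((1 - s) * x) / x) * (sin ((1 - t) * x) / x))
      \<longlongrightarrow> s * t - q * (1 - s) * (1 - t)) (at_right 0)"
    by (intro tendsto_intros sinc)
  hence "eventually (\<lambda>x. sin (s * x) / x * (sin (t * x) / x)
      - q * (sin ((1 - s) * x) / x) * (sin ((1 - t) * x) / x) < 0) (at_right 0)"
    by (rule order_tendstoD) (use q in auto)
  moreover have "eventually (\<lambda>x. x \<in> {0<..<T}) (at_right (0::real))"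
    using T by (rule eventually_at_right_real)
  ultimately have "eventually (\<lambda>x. x \<in> {0<..<T} \<and> k x < 0) (at_right 0)"
  proof eventually_elim
    case (elim x)
    have "sin (s * x) / x * (sin (t * x) / x)
      - q * (sin ((1 - s) * x) / x) * (sin ((1 - t) * x) / x) = k x / (x * x)"
      using elim by (simp add: k_def diff_divide_distrib)
    with elim have "k x / (x * x) < 0" "x * x > 0" by simp_all
    with elim show ?case by (simp add: divide_less_0_iff)
  qed
  then obtain x where x: "0 < x" "x < T" "k x < 0"
    using eventually_happens'[OF trivial_limit_at_right_real] by (metis (lifting) greaterThanLessThan_iff)
  obtain \<theta> where \<theta>: "x \<le> \<theta>" "\<theta> \<le> T" "k \<theta> = 0"
  proof -
    have "continuous_on {x..T} k" unfolding k_def by (intro continuous_intros)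
    thus ?thesis using IVT'[of k x 0 T] x kT that by auto
  qed
  have "\<theta> < T" using \<theta> kT by (cases "\<theta> = T") auto
  hence "max (1 - s) (1 - t) * \<theta> < pi"
    using mx by (simp add: T_def field_simps)
  moreover have "(1 - s) * \<theta> \<le> max (1 - s) (1 - t) * \<theta>" "(1 - t) * \<theta> \<le> max (1 - s) (1 - t) * \<theta>"
    using \<theta> x by (auto intro!: mult_right_mono)
  ultimately have "(1 - s) * \<theta> < pi" "(1 - t) * \<theta> < pi"
    by linarith+
  hence "slope_angle_eq q s t \<theta>"
    using \<theta> x by (auto simp: slope_angle_eq_def k_def)
  thus ?thesis by blast
qed

lemma interior_newton_N: "interior newton_N = {(s, t). s > 0 \<and> t > 0 \<and> s + t < 1}"
proof -
  have "newton_N = convex hull (insert 0 (Basis :: (real \<times> real) set))"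
    by (simp add: newton_N_def Basis_prod_def zero_prod_def insert_commute)
  hence "interior newton_N
      = {x. (\<forall>i\<in>Basis. 0 < x \<bullet> i) \<and> (\<Sum>i\<in>Basis. x \<bullet> i) < 1}"
    using interior_std_simplex[where 'a = "real \<times> real"] by simp
  also have "\<dots> = {(s, t). s > 0 \<and> t > 0 \<and> s + t < 1}"
    by (auto simp: Basis_prod_def inner_prod_def)
  finally show ?thesis .
qed

text \<open>For \<open>r < 1\<close> the last inequality is the defining one multiplied by \<open>r\<^sup>2\<close>. For \<open>r > 1\<close> it follows from
  \<open>s t < (1 - s) (1 - t)\<close>, which is \<open>s + t < 1\<close>. Thus one argument finds \<open>u\<close> in
  both regimes.\<close>

lemma slope_regionD:
  assumes r: "r > 0" "r \<noteq> 1" and st: "(s, t) \<in> slope_region r"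
  shows "0 < s" "0 < t" "s + t < 1" "s * t < r\<^sup>2 * (1 - s) * (1 - t)"
proof -
  have "0 < s \<and> 0 < t \<and> s + t < 1 \<and> s * t < r\<^sup>2 * (1 - s) * (1 - t)"
  proof (cases "r < 1")
    case True
    hence *: "0 < s" "0 < t" "(1 - r\<^sup>2) / r\<^sup>2 * s * t + s + t - 1 < 0"
      using st by (auto simp: slope_region_def)
    have "r\<^sup>2 < 1" using True r by (simp add: power_less_one_iff)
    hence "(1 - r\<^sup>2) / r\<^sup>2 * s * t > 0" using * r by simp
    hence "s + t < 1" using * by linarith
    moreover have "r\<^sup>2 * ((1 - r\<^sup>2) / r\<^sup>2 * s * t + s + t - 1) < 0"
      using * r by (simp add: mult_less_0_iff)
    moreover have "r\<^sup>2 * ((1 - r\<^sup>2) / r\<^sup>2 * s * t + s + t - 1)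
        = (1 - r\<^sup>2) * s * t + r\<^sup>2 * (s + t - 1)"
    proof -
      have "r\<^sup>2 * ((1 - r\<^sup>2) / r\<^sup>2) = 1 - r\<^sup>2" using r by simp
      moreover have "r\<^sup>2 * (K * s * t + s + t - 1) = r\<^sup>2 * K * s * t + r\<^sup>2 * (s + t - 1)" for K
        by (simp add: algebra_simps)
      ultimately show ?thesis by metis
    qed
    ultimately have "s * t < r\<^sup>2 * (1 - s) * (1 - t)"
      by (simp add: algebra_simps)
    with \<open>s + t < 1\<close> show ?thesis using * by auto
  next
    case False
    hence *: "0 < s" "0 < t" "s + t < 1"
      using st r by (auto simp: slope_region_def interior_newton_N)
    have "s * t < (1 - s) * (1 - t)" using * by (simp add: algebra_simps)
    also have "\<dots> = 1 * ((1 - s) * (1 - t))" by simp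
    also have "\<dots> \<le> r\<^sup>2 * ((1 - s) * (1 - t))"
      using * False r by (intro mult_right_mono) (auto simp: one_le_power)
    finally show ?thesis using * by (simp add: mult.assoc)
  qed
  thus "0 < s" "0 < t" "s + t < 1" "s * t < r\<^sup>2 * (1 - s) * (1 - t)" by auto
qed

section \<open>The point u\<close>

text \<open>The defining equations of \<open>u\<close> with \<open>\<theta>\<close> as a separate unknown; they force
  \<open>\<theta> = \<pi> - Arg (u - 1) + Arg (u - q)\<close>. The triangle with vertices 0, 1 and \<open>u\<close> has the angles
  \<open>(1 - s - t) \<theta>\<close>, \<open>s \<theta>\<close> and \<open>\<pi> - (1 - t) \<theta>\<close>; the one with vertices 0, \<open>q\<close> and \<open>u\<close> has the angles
  \<open>(1 - s - t) \<theta>\<close>, \<open>\<pi> - (1 - s) \<theta>\<close> and \<open>t \<theta>\<close>.\<close>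

definition slope_triangle :: "real \<Rightarrow> real \<Rightarrow> real \<Rightarrow> real \<Rightarrow> complex \<Rightarrow> bool" where
  "slope_triangle q s t \<theta> u \<longleftrightarrow> Im u > 0 \<and> Arg u = (1 - s - t) * \<theta> \<and>
     Arg (u - of_real q) = (1 - s) * \<theta> \<and> Arg (u - 1) = pi - s * \<theta>"

lemma Im_rotate_Arg: "Im (z * cis (- Arg z)) = 0"
proof -
  have "z * cis (- Arg z) = rcis (cmod z) (Arg z) * cis (- Arg z)" by (simp add: rcis_cmod_Arg)
  also have "\<dots> = of_real (cmod z)" by (simp add: rcis_def mult.assoc cis_mult)
  finally show ?thesis by simp
qed

lemma Arg_upper: "0 < Im z \<Longrightarrow> 0 < Arg z \<and> Arg z < pi"
  using Arg_lt_pi[of z] by auto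

text \<open>The law of sines in the two triangles gives \<open>|u| sin ((1 - t) \<theta>) = sin (s \<theta>)\<close> and
  \<open>|u| sin (t \<theta>) = q sin ((1 - s) \<theta>)\<close>. Elimination of \<open>|u|\<close> leaves the equation for \<open>\<theta>\<close>, and the first
  relation recovers \<open>u\<close> from \<open>\<theta>\<close>.\<close>

lemma slope_triangle_solution:
  assumes st: "0 < s" "0 < t" "s + t < 1" and u: "slope_triangle q s t \<theta> u" and q: "0 < q"
  shows "slope_angle_eq q s t \<theta>"
    and "u = rcis (sin (s * \<theta>) / sin ((1 - t) * \<theta>)) ((1 - s - t) * \<theta>)"
proof -
  define \<alpha> where "\<alpha> = (1 - s - t) * \<theta>"
  have A: "Im u > 0" "Arg u = \<alpha>" "Arg (u - of_real q) = (1 - s) * \<theta>" "Arg (u - 1) = pi - s * \<theta>"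
    using u by (auto simp: slope_triangle_def \<alpha>_def)
  have ang: "0 < \<alpha>" "\<alpha> < pi" "0 < (1 - s) * \<theta>" "(1 - s) * \<theta> < pi" "0 < s * \<theta>" "s * \<theta> < pi"
    using Arg_upper[of u] Arg_upper[of "u - 1"] Arg_upper[of "u - of_real q"] A by auto
  have \<theta>: "\<theta> > 0" using ang(5) st by (simp add: zero_less_mult_iff)
  have pos: "cmod u > 0" using A by auto
  have ru: "u = rcis (cmod u) \<alpha>" using rcis_cmod_Arg[of u] A by simp
  have rot: "u * cis b = rcis (cmod u) (\<alpha> + b)" for b
    using arg_cong[OF ru, of "\<lambda>x. x * cis b"] by (simp add: rcis_def mult.assoc cis_mult)
  have sines: "sin (s * \<theta>) > 0" "sin ((1 - s) * \<theta>) > 0"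
    using ang by (auto intro!: sin_gt_zero)
  have shift: "(1 - t) * \<theta> = \<alpha> + s * \<theta>" "- (t * \<theta>) = \<alpha> - (1 - s) * \<theta>"
    by (auto simp: \<alpha>_def algebra_simps)
  \<comment> \<open>The law of sines: a number rotated back by its argument has imaginary part 0.\<close>
  have e1: "cmod u * sin ((1 - t) * \<theta>) = sin (s * \<theta>)"
  proof -
    have "cis (- Arg (u - 1)) = - cis (s * \<theta>)"
      by (simp add: A complex_eq_iff cos_diff sin_diff)
    hence "Im ((u - 1) * cis (s * \<theta>)) = 0"
      using Im_rotate_Arg[of "u - 1"] by simp
    moreover have "(u - 1) * cis (s * \<theta>) = rcis (cmod u) ((1 - t) * \<theta>) - cis (s * \<theta>)"
      by (simp only: left_diff_distrib[of u 1] rot shift(1) mult_1)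
    ultimately show ?thesis by simp
  qed
  have e2: "cmod u * sin (t * \<theta>) = q * sin ((1 - s) * \<theta>)"
  proof -
    have "Im ((u - of_real q) * cis (- ((1 - s) * \<theta>))) = 0"
      using Im_rotate_Arg[of "u - of_real q"] by (simp add: A)
    moreover have "(u - of_real q) * cis (- ((1 - s) * \<theta>))
        = rcis (cmod u) (- (t * \<theta>)) - of_real q * cis (- ((1 - s) * \<theta>))"
    proof -
      have "u * cis (- ((1 - s) * \<theta>)) = rcis (cmod u) (- (t * \<theta>))"
        unfolding shift(2) using rot[of "- ((1 - s) * \<theta>)"] by simp
      thus ?thesis by (simp only: left_diff_distrib[of u "of_real q"])
    qed
    ultimately show ?thesis by simp
  qed
  \<comment> \<open>A priori \<open>(1 - t) \<theta>\<close> is only a sum of two angles below \<open>\<pi>\<close>; its positive sine bounds it by \<open>\<pi>\<close>.\<close>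
  have "sin ((1 - t) * \<theta>) > 0"
    using e1 sines pos by (metis zero_less_mult_pos)
  moreover have "(1 - t) * \<theta> < 2 * pi" "0 < (1 - t) * \<theta>"
    using ang shift by auto
  ultimately have small: "(1 - t) * \<theta> < pi"
    using sin_le_zero[of "(1 - t) * \<theta>"] by linarith
  have u_abs: "cmod u = sin (s * \<theta>) / sin ((1 - t) * \<theta>)"
    using e1 \<open>sin ((1 - t) * \<theta>) > 0\<close> by (simp add: field_simps)
  show "u = rcis (sin (s * \<theta>) / sin ((1 - t) * \<theta>)) ((1 - s - t) * \<theta>)"
    using ru u_abs \<alpha>_def by simp
  have "sin (s * \<theta>) * sin (t * \<theta>) = q * sin ((1 - s) * \<theta>) * sin ((1 - t) * \<theta>)"
    using e2 \<open>sin ((1 - t) * \<theta>) > 0\<close> by (simp add: u_abs field_simps)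
  thus "slope_angle_eq q s t \<theta>"
    using \<theta> small ang by (simp add: slope_angle_eq_def)
qed

lemma sine_law_left: "of_real (sin b) * cis a - of_real (sin (a + b)) = rcis (sin a) (pi - b)"
  by (simp add: complex_eq_iff sin_add algebra_simps)

lemma sine_law_right: "of_real (sin (a + c)) * cis a - of_real (sin c) = rcis (sin a) (a + c)"
proof -
  have "sin c = sin ((a + c) - a)" by simp
  also have "\<dots> = sin (a + c) * cos a - cos (a + c) * sin a" by (rule sin_diff)
  finally show ?thesis by (simp add: complex_eq_iff mult.commute)
qed

text \<open>The converse of \<open>slope_triangle_solution\<close>. The polar forms of \<open>u\<close>, \<open>u - 1\<close> and \<open>u - q\<close> are kept because
  those of \<open>w\<close>, \<open>z\<close>, \<open>1 - w\<close> and \<open>1 - z\<close> are quotients of them.\<close>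

lemma slope_triangle_polar:
  assumes st: "0 < s" "0 < t" "s + t < 1" and q: "0 < q" and \<theta>: "slope_angle_eq q s t \<theta>"
  defines "u \<equiv> rcis (sin (s * \<theta>) / sin ((1 - t) * \<theta>)) ((1 - s - t) * \<theta>)"
  shows "\<exists>\<rho>\<^sub>0 \<rho>\<^sub>1 \<rho>\<^sub>q. 0 < \<rho>\<^sub>0 \<and> 0 < \<rho>\<^sub>1 \<and> 0 < \<rho>\<^sub>q \<and> u = rcis \<rho>\<^sub>0 ((1 - s - t) * \<theta>) \<and>
      u - 1 = rcis \<rho>\<^sub>1 (pi - s * \<theta>) \<and> u - of_real q = rcis \<rho>\<^sub>q ((1 - s) * \<theta>)"
    and "slope_triangle q s t \<theta> u"
proof -
  have th: "0 < \<theta>" "(1 - s) * \<theta> < pi" "(1 - t) * \<theta> < pi"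
    and sin_eq: "sin (s * \<theta>) * sin (t * \<theta>) = q * sin ((1 - s) * \<theta>) * sin ((1 - t) * \<theta>)"
    using \<theta> by (auto simp: slope_angle_eq_def)
  have ang: "0 < s * \<theta>" "0 < t * \<theta>" "0 < (1 - s - t) * \<theta>" "s * \<theta> < pi" "t * \<theta> < pi"
    "(1 - s - t) * \<theta> < pi" "0 < (1 - s) * \<theta>" "0 < (1 - t) * \<theta>"
  proof -
    have "s * \<theta> \<le> (1 - t) * \<theta>" "t * \<theta> \<le> (1 - s) * \<theta>" "(1 - s - t) * \<theta> \<le> (1 - s) * \<theta>"
      using st th(1) by (auto intro!: mult_right_mono)
    thus "s * \<theta> < pi" "t * \<theta> < pi" "(1 - s - t) * \<theta> < pi" using th by linarith+
  qed (use st th in auto)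
  define S where "S = sin (s * \<theta>)"
  define S' where "S' = sin ((1 - s) * \<theta>)"
  define T where "T = sin (t * \<theta>)"
  define T' where "T' = sin ((1 - t) * \<theta>)"
  define R where "R = sin ((1 - s - t) * \<theta>)"
  have pos: "S > 0" "S' > 0" "T > 0" "T' > 0" "R > 0"
    unfolding S_def S'_def T_def T'_def R_def using ang th by (auto intro!: sin_gt_zero)
  have q_eq: "q = S * T / (S' * T')"
    using sin_eq pos by (simp add: S_def S'_def T_def T'_def field_simps)
  have u: "u = rcis (S / T') ((1 - s - t) * \<theta>)" by (simp add: u_def S_def T'_def)
  have split1: "(1 - t) * \<theta> = (1 - s - t) * \<theta> + s * \<theta>"
    and split2: "(1 - s) * \<theta> = (1 - s - t) * \<theta> + t * \<theta>"
    by (auto simp: algebra_simps)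
  have "of_real S * cis ((1 - s - t) * \<theta>) - of_real T' = rcis R (pi - s * \<theta>)"
    unfolding S_def T'_def R_def split1 by (rule sine_law_left)
  hence 1: "u - 1 = rcis (R / T') (pi - s * \<theta>)"
    using pos by (simp add: u rcis_def field_simps)
  have "of_real S' * cis ((1 - s - t) * \<theta>) - of_real T = rcis R ((1 - s) * \<theta>)"
    unfolding S'_def T_def R_def split2 by (rule sine_law_right)
  hence "of_real (S / (S' * T')) * (of_real S' * cis ((1 - s - t) * \<theta>) - of_real T)
      = of_real (S / (S' * T')) * rcis R ((1 - s) * \<theta>)" by simp
  hence 2: "u - of_real q = rcis (S * R / (S' * T')) ((1 - s) * \<theta>)"
    using pos by (simp add: u q_eq rcis_def field_simps)
  show "\<exists>\<rho>\<^sub>0 \<rho>\<^sub>1 \<rho>\<^sub>q. 0 < \<rho>\<^sub>0 \<and> 0 < \<rho>\<^sub>1 \<and> 0 < \<rho>\<^sub>q \<and> u = rcis \<rho>\<^sub>0 ((1 - s - t) * \<theta>) \<and>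
      u - 1 = rcis \<rho>\<^sub>1 (pi - s * \<theta>) \<and> u - of_real q = rcis \<rho>\<^sub>q ((1 - s) * \<theta>)"
    using u 1 2 pos by (intro exI[of _ "S / T'"] exI[of _ "R / T'"] exI[of _ "S * R / (S' * T')"]) auto
  have "Arg u = (1 - s - t) * \<theta>"
    by (rule Arg_unique'[OF _ _ u]) (use ang pos in auto)
  moreover have "Arg (u - 1) = pi - s * \<theta>"
    by (rule Arg_unique'[OF _ _ 1]) (use ang pos in auto)
  moreover have "Arg (u - of_real q) = (1 - s) * \<theta>"
    by (rule Arg_unique'[OF _ _ 2]) (use ang th pos in auto)
  moreover have "Im u > 0" using pos by (simp add: u R_def[symmetric])
  ultimately show "slope_triangle q s t \<theta> u" by (simp add: slope_triangle_def)
qed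

lemma u_of_polar:
  assumes r: "r > 0" "r \<noteq> 1" and st: "(s, t) \<in> slope_region r"
  obtains \<theta> \<rho>\<^sub>0 \<rho>\<^sub>1 \<rho>\<^sub>q where "slope_angle_eq (r\<^sup>2) s t \<theta>" "0 < \<rho>\<^sub>0" "0 < \<rho>\<^sub>1" "0 < \<rho>\<^sub>q"
    "u_of r s t = rcis \<rho>\<^sub>0 ((1 - s - t) * \<theta>)"
    "u_of r s t - 1 = rcis \<rho>\<^sub>1 (pi - s * \<theta>)"
    "u_of r s t - of_real (r\<^sup>2) = rcis \<rho>\<^sub>q ((1 - s) * \<theta>)"
proof -
  note D = slope_regionD[OF r st]
  have q: "0 < r\<^sup>2" using r by simp
  have equations: "(Im u > 0
      \<and> s * theta_angle r u = pi - Arg (u - 1)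
      \<and> t * theta_angle r u = Arg (u - of_real (r\<^sup>2)) - Arg u
      \<and> (1 - s - t) * theta_angle r u = Arg u)
    \<longleftrightarrow> (\<exists>\<theta>. slope_triangle (r\<^sup>2) s t \<theta> u)" (is "?L \<longleftrightarrow> ?R") for u
  proof
    assume ?L
    hence "slope_triangle (r\<^sup>2) s t (theta_angle r u) u"
      unfolding slope_triangle_def by (auto simp: algebra_simps)
    thus ?R ..
  next
    assume ?R
    then obtain \<theta> where *: "slope_triangle (r\<^sup>2) s t \<theta> u" ..
    hence "theta_angle r u = \<theta>"
      by (simp add: slope_triangle_def theta_angle_def algebra_simps)
    with * show ?L by (auto simp: slope_triangle_def algebra_simps)
  qed
  obtain \<theta> where \<theta>: "slope_angle_eq (r\<^sup>2) s t \<theta>"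
    using slope_angle_eq_ex[OF D] by blast
  define u where "u = rcis (sin (s * \<theta>) / sin ((1 - t) * \<theta>)) ((1 - s - t) * \<theta>)"
  have "u_of r s t = u"
    unfolding u_of_def equations
  proof (rule the_equality)
    show "\<exists>\<theta>. slope_triangle (r\<^sup>2) s t \<theta> u"
      using slope_triangle_polar(2)[OF D(1-3) q \<theta>] by (auto simp: u_def)
    fix u' assume "\<exists>\<theta>. slope_triangle (r\<^sup>2) s t \<theta> u'"
    then obtain \<phi> where \<phi>: "slope_triangle (r\<^sup>2) s t \<phi> u'" ..
    have "\<phi> = \<theta>"
      using slope_angle_eq_unique[OF D(1-3) slope_triangle_solution(1)[OF D(1-3) \<phi> q] \<theta>] .
    thus "u' = u" using slope_triangle_solution(2)[OF D(1-3) \<phi> q] by (simp add: u_def)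
  qed
  thus ?thesis
    using slope_triangle_polar(1)[OF D(1-3) q \<theta>] \<theta> that by (auto simp: u_def)
qed

section \<open>The arguments of w and z\<close>

text \<open>The common shape of the arguments of \<open>w\<close> (with slope \<open>s\<close>) and of the conjugate of \<open>z\<close> (with
  slope \<open>t\<close>). The sign \<open>\<epsilon>\<close> is 1 for \<open>r < 1\<close> and -1 for \<open>r > 1\<close>. The shift \<open>(1 - \<epsilon>) \<pi> / 2\<close> is accordingly
  0 or \<open>\<pi>\<close>, so that \<open>Arg v\<close> is \<open>s \<theta>\<close> or \<open>\<pi> - s \<theta>\<close>.\<close>

definition slope_angles :: "real \<Rightarrow> real \<Rightarrow> real \<Rightarrow> complex \<Rightarrow> bool" where
  "slope_angles \<epsilon> \<theta> s v \<longleftrightarrow> Im v > 0 \<and> Arg v = (1 - \<epsilon>) / 2 * pi + \<epsilon> * (s * \<theta>) \<and>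
     Arg (1 - v) = - ((1 - \<epsilon>) / 2 * pi) - \<epsilon> * ((1 - s) * \<theta>)"

lemma slope_anglesI:
  assumes "0 < a" "0 < b" "v = rcis a \<alpha>" "1 - v = rcis b \<beta>"
    "\<alpha> = (1 - \<epsilon>) / 2 * pi + \<epsilon> * (s * \<theta>)" "\<beta> = - ((1 - \<epsilon>) / 2 * pi) - \<epsilon> * ((1 - s) * \<theta>)"
    "0 < \<alpha>" "\<alpha> < pi" "- pi < \<beta>" "\<beta> \<le> pi"
  shows "slope_angles \<epsilon> \<theta> s v"
proof -
  have "Arg v = \<alpha>"
    by (rule Arg_unique'[OF assms(1) _ assms(3)]) (use assms(7,8) in auto)
  moreover have "Arg (1 - v) = \<beta>"
    by (rule Arg_unique'[OF assms(2) _ assms(4)]) (use assms(9,10) in auto)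
  moreover have "Im v > 0" using assms by (auto intro!: mult_pos_pos sin_gt_zero)
  ultimately show ?thesis using assms by (simp add: slope_angles_def)
qed

definition phase_sign :: "real \<Rightarrow> real" where
  "phase_sign r = (if r < 1 then 1 else -1)"

text \<open>The four numbers \<open>w\<close>, \<open>1 - w\<close>, \<open>z\<close> and \<open>1 - z\<close> are, up to conjugation, real multiples of
  \<open>1 - u\<close>, \<open>u - r\<^sup>2\<close>, \<open>(u - r\<^sup>2) / u\<close> and \<open>(1 - u) / u\<close>, and the arguments of \<open>u\<close>, \<open>u - 1\<close> and
  \<open>u - r\<^sup>2\<close> are known multiples of \<open>\<theta>\<close>.\<close>

lemma slope_angles_w_z:
  assumes r: "r > 0" "r \<noteq> 1" and st: "(s, t) \<in> slope_region r"
  shows "\<exists>\<theta>>0. slope_angles (phase_sign r) \<theta> s (w_of r s t)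
      \<and> slope_angles (phase_sign r) \<theta> t (cnj (z_of r s t))"
    and "1 - w_of r s t - z_of r s t + of_real (1 - r\<^sup>2) * w_of r s t * z_of r s t = 0"
proof -
  obtain \<theta> \<rho>\<^sub>0 \<rho>\<^sub>1 \<rho>\<^sub>q where \<theta>: "slope_angle_eq (r\<^sup>2) s t \<theta>" and \<rho>: "0 < \<rho>\<^sub>0" "0 < \<rho>\<^sub>1" "0 < \<rho>\<^sub>q"
    and P: "u_of r s t = rcis \<rho>\<^sub>0 ((1 - s - t) * \<theta>)"
    "u_of r s t - 1 = rcis \<rho>\<^sub>1 (pi - s * \<theta>)"
    "u_of r s t - of_real (r\<^sup>2) = rcis \<rho>\<^sub>q ((1 - s) * \<theta>)"
    using u_of_polar[OF r st] .
  define u where "u = u_of r s t"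
  define q where "q = r\<^sup>2"
  define a where "a = s * \<theta>"
  define b where "b = t * \<theta>"
  have q: "q > 0" using r by (simp add: q_def)
  have th: "0 < \<theta>" "(1 - s) * \<theta> < pi" "(1 - t) * \<theta> < pi"
    using \<theta> by (auto simp: slope_angle_eq_def)
  note D = slope_regionD[OF r st]
  have "0 < a" "0 < b" "a + b < \<theta>" "\<theta> - a < pi" "\<theta> - b < pi"
    using D th mult_strict_right_mono[of "s + t" 1 \<theta>]
    by (auto simp: a_def b_def algebra_simps)
  hence ang: "0 < a" "0 < b" "a + b < \<theta>" "\<theta> - a < pi" "\<theta> - b < pi" "a < pi" "b < pi"
    by auto
  have angles: "(1 - s - t) * \<theta> = \<theta> - a - b" "(1 - s) * \<theta> = \<theta> - a" "(1 - t) * \<theta> = \<theta> - b"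
    by (auto simp: a_def b_def algebra_simps)
  have u: "u = rcis \<rho>\<^sub>0 (\<theta> - a - b)" "u - 1 = rcis \<rho>\<^sub>1 (pi - a)" "u - of_real q = rcis \<rho>\<^sub>q (\<theta> - a)"
    using P unfolding angles a_def[symmetric] u_def[symmetric] q_def[symmetric] by auto
  have u0: "u \<noteq> 0" using u(1) \<rho> by (auto simp: rcis_def)
  have neg_u: "1 - u = rcis \<rho>\<^sub>1 (- a)" "of_real q - u = rcis \<rho>\<^sub>q (\<theta> - a - pi)"
  proof -
    have neg: "- rcis x (y + pi) = rcis x y" for x y by (simp add: complex_eq_iff)
    show "1 - u = rcis \<rho>\<^sub>1 (- a)"
      using arg_cong[OF u(2), of uminus] neg[of \<rho>\<^sub>1 "- a"] by simp
    show "of_real q - u = rcis \<rho>\<^sub>q (\<theta> - a - pi)"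
      using arg_cong[OF u(3), of uminus] neg[of \<rho>\<^sub>q "\<theta> - a - pi"] by simp
  qed
  have conj: "cnj (rcis x y) = rcis x (- y)" for x y by (simp add: rcis_def cis_cnj)
  have scale: "rcis x y / of_real k = rcis (x / k) y" for x y k by (simp add: rcis_def)
  have scale': "of_real k * rcis x y = rcis (k * x) y" for x y k by (simp add: rcis_def)
  have all: "slope_angles (phase_sign r) \<theta> s (w_of r s t) \<and> slope_angles (phase_sign r) \<theta> t (cnj (z_of r s t))
     \<and> 1 - w_of r s t - z_of r s t + of_real (1 - r\<^sup>2) * w_of r s t * z_of r s t = 0"
  proof (cases "r < 1")
    case True
    define c where "c = 1 - q"
    have c: "c > 0" using True r by (simp add: c_def q_def power_less_one_iff)
    have w: "w_of r s t = (1 - cnj u) / of_real c" and z: "z_of r s t = (1 - of_real q / cnj u) / of_real c"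
      using True by (simp_all add: w_of_def z_of_def Let_def u_def c_def q_def)
    have v: "cnj (z_of r s t) = (u - of_real q) / u / of_real c"
      using u0 by (simp add: z diff_divide_distrib)
    have v': "1 - cnj (z_of r s t) = of_real q * (1 - u) / u / of_real c"
      unfolding v using u0 c by (simp add: field_simps) (simp add: c_def algebra_simps)
    have w': "1 - w_of r s t = cnj (u - of_real q) / of_real c"
      unfolding w using c by (simp add: field_simps) (simp add: c_def algebra_simps)
    have "slope_angles 1 \<theta> s (w_of r s t)"
    proof (rule slope_anglesI)
      show "w_of r s t = rcis (\<rho>\<^sub>1 / c) a"
        using arg_cong[OF neg_u(1), of cnj] by (simp add: w conj scale)
      show "1 - w_of r s t = rcis (\<rho>\<^sub>q / c) (- (\<theta> - a))"
        by (simp only: w' u(3) conj scale)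
    qed (use c \<rho> ang D(1-3) in \<open>auto simp: a_def angles(2)\<close>)
    moreover have "slope_angles 1 \<theta> t (cnj (z_of r s t))"
    proof (rule slope_anglesI)
      show "cnj (z_of r s t) = rcis (\<rho>\<^sub>q / \<rho>\<^sub>0 / c) b"
        unfolding v u(3) by (subst u(1)) (simp add: rcis_divide scale)
      show "1 - cnj (z_of r s t) = rcis (q * \<rho>\<^sub>1 / \<rho>\<^sub>0 / c) (- (\<theta> - b))"
        unfolding v' neg_u by (subst u(1)) (simp add: rcis_divide scale scale')
    qed (use c q \<rho> ang D(1-3) in \<open>auto simp: b_def angles(3)\<close>)
    moreover have "1 - w_of r s t - z_of r s t + of_real c * w_of r s t * z_of r s t = 0"
      unfolding w z using u0 c
      by (simp add: field_simps) (simp add: c_def algebra_simps)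
    ultimately show ?thesis using True by (simp add: phase_sign_def c_def q_def)
  next
    case False
    define c where "c = q - 1"
    have c: "c > 0" using False r by (simp add: c_def q_def)
    have w: "w_of r s t = (u - 1) / of_real c" and z: "z_of r s t = (of_real q / u - 1) / of_real c"
      using False by (simp_all add: w_of_def z_of_def Let_def u_def c_def q_def)
    have v: "z_of r s t = (of_real q - u) / u / of_real c"
      using u0 by (simp add: z diff_divide_distrib)
    have v': "1 - z_of r s t = of_real q * (u - 1) / u / of_real c"
      unfolding v using u0 c by (simp add: field_simps) (simp add: c_def algebra_simps)
    have w': "1 - w_of r s t = (of_real q - u) / of_real c"
      unfolding w using c by (simp add: field_simps) (simp add: c_def algebra_simps)
    have "slope_angles (-1) \<theta> s (w_of r s t)"
    proof (rule slope_anglesI)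
      show "w_of r s t = rcis (\<rho>\<^sub>1 / c) (pi - a)"
        by (simp add: w u(2) scale)
      show "1 - w_of r s t = rcis (\<rho>\<^sub>q / c) (\<theta> - a - pi)"
        by (simp add: w' neg_u scale)
    qed (use c \<rho> ang D(1-3) in \<open>auto simp: a_def angles(2)\<close>)
    moreover have "slope_angles (-1) \<theta> t (cnj (z_of r s t))"
    proof (rule slope_anglesI)
      have "z_of r s t = rcis (\<rho>\<^sub>q / \<rho>\<^sub>0 / c) (b - pi)"
        unfolding v neg_u by (subst u(1)) (simp add: rcis_divide scale)
      thus "cnj (z_of r s t) = rcis (\<rho>\<^sub>q / \<rho>\<^sub>0 / c) (pi - b)" by (simp add: conj)
      have "1 - z_of r s t = rcis (q * \<rho>\<^sub>1 / \<rho>\<^sub>0 / c) (pi - (\<theta> - b))"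
        unfolding v' u(2) by (subst u(1)) (simp add: rcis_divide scale scale' algebra_simps)
      from arg_cong[OF this, of cnj]
      show "1 - cnj (z_of r s t) = rcis (q * \<rho>\<^sub>1 / \<rho>\<^sub>0 / c) (\<theta> - b - pi)" by (simp add: conj)
    qed (use c q \<rho> ang D(1-3) in \<open>auto simp: b_def angles(3)\<close>)
    moreover have "1 - w_of r s t - z_of r s t + of_real (- c) * w_of r s t * z_of r s t = 0"
      unfolding w z using u0 c
      by (simp add: field_simps) (simp add: c_def algebra_simps)
    ultimately show ?thesis using False by (simp add: phase_sign_def c_def q_def)
  qed
  show "\<exists>\<theta>>0. slope_angles (phase_sign r) \<theta> s (w_of r s t)
      \<and> slope_angles (phase_sign r) \<theta> t (cnj (z_of r s t))"
    using all th by blast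
  show "1 - w_of r s t - z_of r s t + of_real (1 - r\<^sup>2) * w_of r s t * z_of r s t = 0"
    using all by blast
qed

section \<open>The differential of B\<close>

text \<open>With the value -1 at 0 the integrand is continuous on the plane slit along \<open>[1, \<infinity>)\<close> and holomorphic
  outside 0. The slit plane is starlike, so the integrand has a primitive there, and the segment
  integral is a difference of its values.\<close>

lemma dilog_has_field_derivative:
  assumes z: "Im z > 0"
  shows "(dilog has_field_derivative - (Ln (1 - z) / z)) (at z)"
proof -
  define S where "S = - (complex_of_real ` {1..})"
  define g where "g = (\<lambda>\<zeta>. if \<zeta> = 0 then -1 else Ln (1 - \<zeta>) / \<zeta>)"
  have S: "open S" "starlike S"
    unfolding S_def by (auto simp: open_Compl closed_slot_right starlike_slotted_complex_plane_right)
  have slit: "1 - \<zeta> \<notin> \<real>\<^sub>\<le>\<^sub>0" if "\<zeta> \<in> S" for \<zeta>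
  proof
    assume "1 - \<zeta> \<in> \<real>\<^sub>\<le>\<^sub>0"
    hence "\<zeta> = of_real (Re \<zeta>)" "Re \<zeta> \<ge> 1" by (auto simp: complex_nonpos_Reals_iff complex_eq_iff)
    thus False using that unfolding S_def by blast
  qed
  have diff: "g field_differentiable at \<zeta>" if "\<zeta> \<in> S - {0}" for \<zeta>
  proof -
    have "((\<lambda>\<zeta>. Ln (1 - \<zeta>) / \<zeta>) has_field_derivative (- 1 / (1 - \<zeta>) * \<zeta> - Ln (1 - \<zeta>)) / (\<zeta> * \<zeta>)) (at \<zeta>)"
      using that slit[of \<zeta>] by (auto intro!: derivative_eq_intros simp: inverse_eq_divide)
    hence "(g has_field_derivative (- 1 / (1 - \<zeta>) * \<zeta> - Ln (1 - \<zeta>)) / (\<zeta> * \<zeta>)) (at \<zeta>)"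
      by (rule DERIV_cong_ev[OF refl _ refl, THEN iffD1, rotated])
        (use that in \<open>auto simp: g_def intro!: eventually_mono[OF t1_space_nhds[of \<zeta> 0]]\<close>)
    thus ?thesis by (auto simp: field_differentiable_def)
  qed
  have cont: "continuous_on S g"
  proof (intro continuous_at_imp_continuous_on ballI)
    fix \<zeta> assume \<zeta>: "\<zeta> \<in> S"
    show "isCont g \<zeta>"
    proof (cases "\<zeta> = 0")
      case True
      have "((\<lambda>\<zeta>. Ln (1 - \<zeta>)) has_field_derivative -1) (at 0)"
        by (auto intro!: derivative_eq_intros)
      hence "((\<lambda>\<zeta>. Ln (1 - \<zeta>) / \<zeta>) \<longlongrightarrow> -1) (at 0)"
        by (simp add: has_field_derivative_iff)
      hence "(g \<longlongrightarrow> -1) (at 0)"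
        by (rule Lim_transform_eventually) (auto simp: g_def eventually_at_filter)
      thus ?thesis using True by (simp add: isCont_def g_def)
    next
      case False
      thus ?thesis using diff[of \<zeta>] \<zeta> field_differentiable_imp_continuous_at by blast
    qed
  qed
  obtain G where G: "\<And>\<zeta>. \<zeta> \<in> S \<Longrightarrow> (G has_field_derivative g \<zeta>) (at \<zeta>)"
    using holomorphic_starlike_primitive[OF cont S(2,1), of "{0}"] diff by auto
  have dilog_eq: "dilog x = G 0 - G x" if x: "Im x > 0" for x
  proof -
    have "closed_segment 0 x \<subseteq> S"
      using x by (auto simp: S_def closed_segment_def complex_eq_iff)
    hence "(g has_contour_integral (G x - G 0)) (linepath 0 x)"
      using contour_integral_primitive[of S G g "linepath 0 x"] G
      by (auto intro: has_field_derivative_at_within)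
    hence "contour_integral (linepath 0 x) g = G x - G 0"
      by (rule contour_integral_unique)
    moreover have "contour_integral (linepath 0 x) (\<lambda>\<zeta>. Ln (1 - \<zeta>) / \<zeta>) = contour_integral (linepath 0 x) g"
      using x by (intro contour_integral_spike_finite_simple_path[of "{0}"])
        (auto simp: g_def intro!: simple_path_linepath)
    ultimately show ?thesis by (simp add: dilog_def)
  qed
  have "z \<in> S" using z by (auto simp: S_def)
  hence "((\<lambda>x. G 0 - G x) has_field_derivative - g z) (at z)"
    using G by (auto intro!: derivative_eq_intros)
  hence "(dilog has_field_derivative - g z) (at z)"
  proof (rule DERIV_cong_ev[OF refl _ refl, THEN iffD1, rotated])
    have "eventually (\<lambda>x. x \<in> {x. Im x > 0}) (nhds z)"
      using z by (intro eventually_nhds_in_open open_halfspace_Im_gt) auto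
    thus "eventually (\<lambda>x. G 0 - G x = dilog x) (nhds z)"
      by eventually_elim (simp add: dilog_eq)
  qed
  moreover have "z \<noteq> 0" using z by auto
  ultimately show ?thesis by (simp add: g_def)
qed

lemma polar_parts_have_derivatives:
  assumes "Im z \<noteq> 0"
  shows Arg_has_derivative: "(Arg has_derivative (\<lambda>h. Im (h / z))) (at z)"
    and ln_cmod_has_derivative: "((\<lambda>z. ln (cmod z)) has_derivative (\<lambda>h. Re (h / z))) (at z)"
proof -
  have "z \<notin> \<real>\<^sub>\<le>\<^sub>0" using assms by (auto simp: complex_nonpos_Reals_iff)
  hence "(Ln has_derivative (\<lambda>h. inverse z * h)) (at z)"
    using has_field_derivative_Ln[of z] by (simp add: has_field_derivative_def)
  hence d: "(Ln has_derivative (\<lambda>h. h / z)) (at z)"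
    by (simp add: field_simps)
  have "z \<in> - {0}" using assms by auto
  have eq: "\<And>x. x \<in> - {0} \<Longrightarrow> Im (Ln x) = Arg x" "\<And>x. x \<in> - {0} \<Longrightarrow> Re (Ln x) = ln (cmod x)"
    by (simp_all add: Arg_eq_Im_Ln)
  show "(Arg has_derivative (\<lambda>h. Im (h / z))) (at z)"
    using has_derivative_Im[OF d] _ \<open>z \<in> - {0}\<close> eq(1)
    by (rule has_derivative_transform_within_open) auto
  show "((\<lambda>z. ln (cmod z)) has_derivative (\<lambda>h. Re (h / z))) (at z)"
    using has_derivative_Re[OF d] _ \<open>z \<in> - {0}\<close> eq(2)
    by (rule has_derivative_transform_within_open) auto
qed

lemma ln_cmod_one_minus_has_derivative:
  assumes "Im z \<noteq> 0"
  shows "((\<lambda>z. ln (cmod (1 - z))) has_derivative (\<lambda>h. Re (- h / (1 - z)))) (at z)"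
proof -
  have "((\<lambda>z. 1 - z) has_derivative uminus) (at z)"
    by (auto intro!: derivative_eq_intros)
  from has_derivative_compose[OF this ln_cmod_has_derivative[of "1 - z"]]
  show ?thesis using assms by simp
qed

text \<open>The term \<open>log |1 - z| d Arg z\<close> from the product rule cancels against the imaginary part of
  \<open>- Ln (1 - z) dz / z\<close>. What remains contains only differentials of moduli, with arguments as
  coefficients.\<close>

lemma B_fun_has_derivative:
  assumes z: "Im z > 0"
  shows "(B_fun has_derivative (\<lambda>h. (Arg z * Re (- h / (1 - z)) - Arg (1 - z) * Re (h / z)) / pi)) (at z)"
proof -
  have nz: "z \<noteq> 0" "1 - z \<noteq> 0" using z by auto
  have ddilog: "((\<lambda>z. Im (dilog z)) has_derivative (\<lambda>h. Im (- (Ln (1 - z) / z) * h))) (at z)"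
    using dilog_has_field_derivative[OF z] unfolding has_field_derivative_def
    by (rule has_derivative_Im)
  have "(B_fun has_derivative (\<lambda>h. (Arg z * Re (- h / (1 - z)) + Im (h / z) * ln (cmod (1 - z))
      + Im (- (Ln (1 - z) / z) * h)) / pi)) (at z)"
    unfolding B_fun_def[abs_def]
    using z by (intro bounded_linear.has_derivative[OF bounded_linear_divide]
      has_derivative_add has_derivative_mult ln_cmod_one_minus_has_derivative ddilog Arg_has_derivative) auto
  moreover have "Im (h / z) * ln (cmod (1 - z)) + Im (- (Ln (1 - z) / z) * h) = - (Arg (1 - z) * Re (h / z))" for h
  proof -
    have "Im (- (Ln (1 - z) / z) * h) = - Im (Ln (1 - z) * (h / z))"
      by simp
    also have "\<dots> = - (ln (cmod (1 - z)) * Im (h / z) + Arg (1 - z) * Re (h / z))"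
    proof -
      have "Re (Ln (1 - z)) = ln (cmod (1 - z))" "Im (Ln (1 - z)) = Arg (1 - z)"
        using nz by (simp_all add: Arg_eq_Im_Ln)
      thus ?thesis by (simp only: times_complex.sel)
    qed
    finally show ?thesis by simp
  qed
  ultimately show ?thesis by (simp only: add.assoc diff_conv_add_uminus)
qed

section \<open>Symmetry of second derivatives\<close>

lemma has_derivative_partial_x:
  fixes f :: "real \<times> real \<Rightarrow> real"
  assumes "(f has_derivative f') (at (x, y))"
  shows "((\<lambda>x'. f (x', y)) has_real_derivative f' (1, 0)) (at x)" and "partial_x f (x, y) = f' (1, 0)"
proof -
  have "((\<lambda>x'. (x', y)) has_derivative (\<lambda>h. (h, 0))) (at x)"
    by (auto intro!: derivative_eq_intros)
  from has_derivative_compose[OF this assms]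
  have "((\<lambda>x'. f (x', y)) has_derivative (\<lambda>h. f' (h, 0))) (at x)" .
  moreover have "(\<lambda>h. f' (h, 0)) = (*) (f' (1, 0))"
  proof
    fix h :: real
    have "f' (h *\<^sub>R (1, 0)) = h *\<^sub>R f' (1, 0)"
      by (rule linear_scale[OF has_derivative_linear[OF assms]])
    thus "f' (h, 0) = f' (1, 0) * h" by (simp add: mult.commute)
  qed
  ultimately show *: "((\<lambda>x'. f (x', y)) has_real_derivative f' (1, 0)) (at x)"
    by (simp only: has_field_derivative_def)
  show "partial_x f (x, y) = f' (1, 0)"
    unfolding partial_x_def using DERIV_imp_deriv[OF *] by simp
qed

lemma has_derivative_partial_y:
  fixes f :: "real \<times> real \<Rightarrow> real"
  assumes "(f has_derivative f') (at (x, y))"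
  shows "((\<lambda>y'. f (x, y')) has_real_derivative f' (0, 1)) (at y)" and "partial_y f (x, y) = f' (0, 1)"
proof -
  have "((\<lambda>y'. (x, y')) has_derivative (\<lambda>h. (0, h))) (at y)"
    by (auto intro!: derivative_eq_intros)
  from has_derivative_compose[OF this assms]
  have "((\<lambda>y'. f (x, y')) has_derivative (\<lambda>h. f' (0, h))) (at y)" .
  moreover have "(\<lambda>h. f' (0, h)) = (*) (f' (0, 1))"
  proof
    fix h :: real
    have "f' (h *\<^sub>R (0, 1)) = h *\<^sub>R f' (0, 1)"
      by (rule linear_scale[OF has_derivative_linear[OF assms]])
    thus "f' (0, h) = f' (0, 1) * h" by (simp add: mult.commute)
  qed
  ultimately show *: "((\<lambda>y'. f (x, y')) has_real_derivative f' (0, 1)) (at y)"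
    by (simp only: has_field_derivative_def)
  show "partial_y f (x, y) = f' (0, 1)"
    unfolding partial_y_def using DERIV_imp_deriv[OF *] by simp
qed

text \<open>By the mean value theorem the second difference is \<open>h (G (\<xi>, b + h) - G (\<xi>, b))\<close> for some
  intermediate \<open>\<xi>\<close>, and the differentiability of \<open>G\<close> at the single point \<open>(a, b)\<close> makes the bracket equal
  to \<open>h A (0, 1)\<close> up to an error of order \<open>e h\<close>.\<close>

lemma second_difference:
  fixes F :: "real \<Rightarrow> real \<Rightarrow> real" and G :: "real \<times> real \<Rightarrow> real"
  assumes "open D" "(a, b) \<in> D"
    and F: "\<And>x y. (x, y) \<in> D \<Longrightarrow> ((\<lambda>x'. F x' y) has_real_derivative G (x, y)) (at x)"
    and G: "(G has_derivative A) (at (a, b))" and "e > 0"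
  shows "\<exists>d>0. \<forall>h. 0 < h \<and> h < d \<longrightarrow>
    \<bar>F (a + h) (b + h) - F a (b + h) - F (a + h) b + F a b - h\<^sup>2 * A (0, 1)\<bar> \<le> e * h\<^sup>2"
proof -
  interpret A: bounded_linear A using G by (rule has_derivative_bounded_linear)
  obtain d1 where d1: "d1 > 0" "ball (a, b) d1 \<subseteq> D"
    using assms(1,2) open_contains_ball by blast
  obtain d2 where d2: "d2 > 0"
    "\<And>p. norm (p - (a, b)) < d2 \<Longrightarrow> norm (G p - G (a, b) - A (p - (a, b))) \<le> e / 4 * norm (p - (a, b))"
    using G[unfolded has_derivative_at_alt] \<open>e > 0\<close> by (metis divide_pos_pos zero_less_numeral)
  define d where "d = min d1 d2 / 2"
  have d: "d > 0" using d1 d2 by (simp add: d_def)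
  have "\<bar>F (a + h) (b + h) - F a (b + h) - F (a + h) b + F a b - h\<^sup>2 * A (0, 1)\<bar> \<le> e * h\<^sup>2"
    if h: "0 < h" "h < d" for h
  proof -
    have near: "norm ((x, y) - (a, b)) \<le> 2 * h" if "a \<le> x" "x \<le> a + h" "b \<le> y" "y \<le> b + h" for x y
    proof -
      have "norm ((x, y) - (a, b)) \<le> norm (x - a) + norm (y - b)"
        using norm_Pair_le[of "x - a" "y - b"] by simp
      thus ?thesis using that by simp
    qed
    have inD: "(x, y) \<in> D" if "a \<le> x" "x \<le> a + h" "b \<le> y" "y \<le> b + h" for x y
    proof -
      have "norm ((x, y) - (a, b)) < d1" using near[OF that] h by (simp add: d_def)
      hence "(x, y) \<in> ball (a, b) d1" by (metis mem_ball dist_commute dist_norm)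
      thus ?thesis using d1 by blast
    qed
    have G_near: "\<bar>G (x, y) - G (a, b) - A (x - a, y - b)\<bar> \<le> e / 2 * h"
      if "a \<le> x" "x \<le> a + h" "b \<le> y" "y \<le> b + h" for x y
    proof -
      have "norm ((x, y) - (a, b)) < d2" using near[OF that] h by (simp add: d_def)
      from d2(2)[OF this] have "\<bar>G (x, y) - G (a, b) - A (x - a, y - b)\<bar> \<le> e / 4 * norm ((x, y) - (a, b))"
        by simp
      also have "\<dots> \<le> e / 4 * (2 * h)" using near[OF that] \<open>e > 0\<close> by (intro mult_left_mono) auto
      finally show ?thesis by simp
    qed
    have "\<exists>\<xi>>a. \<xi> < a + h \<and> (F (a + h) (b + h) - F (a + h) b) - (F a (b + h) - F a b)
        = (a + h - a) * (G (\<xi>, b + h) - G (\<xi>, b))"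
    proof (rule MVT2)
      show "a < a + h" using h by simp
      fix x assume "a \<le> x" "x \<le> a + h"
      hence "(x, b + h) \<in> D" "(x, b) \<in> D" using inD h by simp_all
      thus "((\<lambda>x. F x (b + h) - F x b) has_real_derivative G (x, b + h) - G (x, b)) (at x)"
        by (intro DERIV_diff F)
    qed
    then obtain \<xi> where \<xi>: "a < \<xi>" "\<xi> < a + h"
      "F (a + h) (b + h) - F a (b + h) - F (a + h) b + F a b = h * (G (\<xi>, b + h) - G (\<xi>, b))"
      by auto
    have "A (\<xi> - a, h) - A (\<xi> - a, 0) = A (h *\<^sub>R (0, 1))"
      unfolding A.diff[symmetric] by simp
    hence "A (\<xi> - a, h) - A (\<xi> - a, 0) = h * A (0, 1)" unfolding A.scaleR by simp
    moreover have "\<bar>G (\<xi>, b + h) - G (a, b) - A (\<xi> - a, h)\<bar> \<le> e / 2 * h"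
      "\<bar>G (\<xi>, b) - G (a, b) - A (\<xi> - a, 0)\<bar> \<le> e / 2 * h"
      using G_near[of \<xi> "b + h"] G_near[of \<xi> b] \<xi> h by simp_all
    ultimately have "\<bar>G (\<xi>, b + h) - G (\<xi>, b) - h * A (0, 1)\<bar> \<le> e / 2 * h + e / 2 * h"
      by linarith
    hence "\<bar>G (\<xi>, b + h) - G (\<xi>, b) - h * A (0, 1)\<bar> \<le> e * h"
      by simp
    hence "h * \<bar>G (\<xi>, b + h) - G (\<xi>, b) - h * A (0, 1)\<bar> \<le> h * (e * h)"
      using h by (intro mult_left_mono) auto
    moreover have "h * \<bar>G (\<xi>, b + h) - G (\<xi>, b) - h * A (0, 1)\<bar>
        = \<bar>h * (G (\<xi>, b + h) - G (\<xi>, b)) - h\<^sup>2 * A (0, 1)\<bar>"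
    proof -
      have "h * (G (\<xi>, b + h) - G (\<xi>, b)) - h\<^sup>2 * A (0, 1)
          = h * (G (\<xi>, b + h) - G (\<xi>, b) - h * A (0, 1))"
        by (simp add: power2_eq_square algebra_simps)
      thus ?thesis using h by (simp only: abs_mult abs_of_pos)
    qed
    ultimately show ?thesis unfolding \<xi>(3) by (simp only: power2_eq_square mult.left_commute)
  qed
  thus ?thesis using d by blast
qed

text \<open>Young's theorem: the second difference of \<open>f\<close> is symmetric in the two variables, and divided by
  \<open>h\<^sup>2\<close> it tends to either mixed derivative.\<close>

lemma mixed_partials_commute:
  fixes f :: "real \<times> real \<Rightarrow> real"
  assumes D: "open D" "(a, b) \<in> D" and f: "\<And>p. p \<in> D \<Longrightarrow> f differentiable (at p)"
    and A: "(partial_x f has_derivative A) (at (a, b))" and B: "(partial_y f has_derivative B) (at (a, b))"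
  shows "A (0, 1) = B (1, 0)"
proof -
  have "\<bar>A (0, 1) - B (1, 0)\<bar> \<le> e" if "e > 0" for e
  proof -
    obtain d1 where d1: "d1 > 0" "\<And>h. 0 < h \<Longrightarrow> h < d1 \<Longrightarrow>
      \<bar>f (a + h, b + h) - f (a, b + h) - f (a + h, b) + f (a, b) - h\<^sup>2 * A (0, 1)\<bar> \<le> e / 2 * h\<^sup>2"
    proof -
      have "((\<lambda>x'. f (x', y)) has_real_derivative partial_x f (x, y)) (at x)" if "(x, y) \<in> D" for x y
        using f[OF that] by (auto simp: differentiable_def has_derivative_partial_x)
      from second_difference[OF D this A, of "e / 2"] \<open>e > 0\<close> that show ?thesis by auto
    qed
    obtain d2 where d2: "d2 > 0" "\<And>h. 0 < h \<Longrightarrow> h < d2 \<Longrightarrow>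
      \<bar>f (a + h, b + h) - f (a + h, b) - f (a, b + h) + f (a, b) - h\<^sup>2 * B (1, 0)\<bar> \<le> e / 2 * h\<^sup>2"
    proof -
      \<comment> \<open>The same estimate with the roles of the variables exchanged.\<close>
      define D' where "D' = prod.swap -` D"
      have D': "open D'" "(b, a) \<in> D'"
        using D by (auto simp: D'_def intro!: open_vimage continuous_on_swap)
      have "((\<lambda>y'. f (x, y')) has_real_derivative (partial_y f \<circ> prod.swap) (y, x)) (at y)" if "(y, x) \<in> D'" for y x
      proof -
        have "(x, y) \<in> D" using that by (simp add: D'_def)
        from f[OF this] show ?thesis by (auto simp: differentiable_def has_derivative_partial_y)
      qed
      moreover have "((partial_y f \<circ> prod.swap) has_derivative (B \<circ> prod.swap)) (at (b, a))"
      proof (rule diff_chain_at)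
        show "(prod.swap has_derivative prod.swap) (at (b, a))"
          unfolding prod.swap_def by (auto intro!: derivative_eq_intros)
        show "(partial_y f has_derivative B) (at (prod.swap (b, a)))" using B by simp
      qed
      ultimately show ?thesis
        using second_difference[OF D', of "\<lambda>y x. f (x, y)" "partial_y f \<circ> prod.swap" "B \<circ> prod.swap" "e / 2"]
          \<open>e > 0\<close> that by auto
    qed
    obtain h where h: "0 < h" "h < d1" "h < d2"
      using d1(1) d2(1) field_lbound_gt_zero by blast
    have "\<bar>h\<^sup>2 * A (0, 1) - h\<^sup>2 * B (1, 0)\<bar> \<le> e * h\<^sup>2"
      using d1(2)[OF h(1,2)] d2(2)[OF h(1,3)] by linarith
    hence "h\<^sup>2 * \<bar>A (0, 1) - B (1, 0)\<bar> \<le> h\<^sup>2 * e"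
      by (simp only: right_diff_distrib[symmetric] abs_mult abs_power2 mult.commute[of e])
    thus ?thesis using h(1) by simp
  qed
  hence "\<not> 0 < \<bar>A (0, 1) - B (1, 0)\<bar> / 2"
    by (metis abs_ge_zero field_sum_of_halves less_add_same_cancel1 linorder_not_less)
  thus ?thesis by simp
qed

section \<open>Analytic functions of a coordinate\<close>

text \<open>By invariance of domain \<open>\<phi>\<close> is a homeomorphism onto an open set, and the inverse has derivative
  \<open>inv \<phi>'\<close>. Composition with \<open>F\<close> leaves multiplication by \<open>c\<close>, which is complex linear.\<close>

lemma holomorphic_factor:
  fixes \<phi> F :: "real \<times> real \<Rightarrow> complex"
  assumes U: "open U" and inj: "inj_on \<phi> U"
    and diff: "\<And>p. p \<in> U \<Longrightarrow>
      \<exists>\<phi>' c. (\<phi> has_derivative \<phi>') (at p) \<and> bij \<phi>' \<and> (F has_derivative (\<lambda>h. c * \<phi>' h)) (at p)"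
  shows "\<exists>f. f analytic_on (\<phi> ` U) \<and> (\<forall>p\<in>U. f (\<phi> p) = F p)"
proof -
  have cont: "continuous_on U \<phi>"
    using diff has_derivative_continuous by (intro continuous_at_imp_continuous_on) blast
  have dim: "DIM(complex) \<le> DIM(real \<times> real)" by simp
  have op: "open (\<phi> ` U)"
    using invariance_of_domain_gen[OF U cont inj dim] .
  obtain g where g: "homeomorphism U (\<phi> ` U) \<phi> g"
    using invariance_of_domain_homeomorphism[OF U cont dim inj] .
  have "(F \<circ> g) field_differentiable at (\<phi> p)" if p: "p \<in> U" for p
  proof -
    obtain \<phi>' c where \<phi>': "(\<phi> has_derivative \<phi>') (at p)" "bij \<phi>'"
      and F: "(F has_derivative (\<lambda>h. c * \<phi>' h)) (at p)"
      using diff[OF p] by blast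
    have gp: "g (\<phi> p) = p" using g p by (simp add: homeomorphism_apply1)
    have lin: "linear \<phi>'" using \<phi>'(1) by (rule has_derivative_linear)
    have "linear (inv \<phi>')"
      using \<phi>'(2)
      by (intro linearI inv_f_eq)
        (auto simp: bij_is_inj bij_is_surj surj_f_inv_f linear_add[OF lin] linear_scale[OF lin])
    hence inv: "bounded_linear (inv \<phi>')" by (simp add: linear_conv_bounded_linear)
    have "(g has_derivative inv \<phi>') (at (\<phi> p))"
    proof (rule has_derivative_inverse_basic[OF _ inv _ _ op])
      show "(\<phi> has_derivative \<phi>') (at (g (\<phi> p)))" using \<phi>' gp by simp
      show "inv \<phi>' \<circ> \<phi>' = id" using \<phi>'(2) by (simp add: bij_is_inj)
      show "continuous (at (\<phi> p)) g"
        using g op p by (auto simp: homeomorphism_def continuous_on_eq_continuous_at)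
      show "\<And>z. z \<in> \<phi> ` U \<Longrightarrow> \<phi> (g z) = z" using g by (simp add: homeomorphism_apply2)
    qed (use p in auto)
    from diff_chain_at[OF this, of F "\<lambda>h. c * \<phi>' h"] F gp
    have "((F \<circ> g) has_derivative (\<lambda>h. c * \<phi>' h) \<circ> inv \<phi>') (at (\<phi> p))" by simp
    moreover have "(\<lambda>h. c * \<phi>' h) \<circ> inv \<phi>' = (*) c"
      using \<phi>'(2) by (auto simp: fun_eq_iff bij_is_surj surj_f_inv_f)
    ultimately show ?thesis
      by (auto simp: field_differentiable_def has_field_derivative_def)
  qed
  hence "(F \<circ> g) holomorphic_on (\<phi> ` U)"
    by (auto simp: holomorphic_on_def intro: field_differentiable_at_within)
  hence "(F \<circ> g) analytic_on (\<phi> ` U)"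
    using op by (simp add: analytic_on_open)
  moreover have "\<forall>p\<in>U. (F \<circ> g) (\<phi> p) = F p"
    using g by (simp add: homeomorphism_apply1)
  ultimately show ?thesis by blast
qed

section \<open>The differential forms of the surface tension\<close>

text \<open>Both components of the gradient of the surface tension are this function of the conjugate of \<open>z\<close>,
  respectively of \<open>w\<close>, up to an additive constant.\<close>

definition slope_potential :: "real \<Rightarrow> complex \<Rightarrow> real" where
  "slope_potential \<epsilon> v = - \<epsilon> * B_fun v - (1 - \<epsilon>) / 2 * ln (cmod (v * (1 - v)))"

lemma sigma_eq_slope_potential:
  assumes "r > 0"
  shows "sigma_s r s t = - ln \<bar>1 - r\<^sup>2\<bar> + slope_potential (phase_sign r) (cnj (z_of r s t))"
    and "sigma_t r s t = - ln \<bar>1 - r\<^sup>2\<bar> + slope_potential (phase_sign r) (w_of r s t)"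
proof -
  have "cmod (1 - cnj x) = cmod (1 - x)" for x
    by (metis complex_cnj_diff complex_cnj_one complex_mod_cnj)
  moreover have "\<bar>1 - r\<^sup>2\<bar> = (if r < 1 then 1 - r\<^sup>2 else r\<^sup>2 - 1)"
    using assms by (simp add: power_le_one abs_square_le_1 one_le_power)
  ultimately show "sigma_s r s t = - ln \<bar>1 - r\<^sup>2\<bar> + slope_potential (phase_sign r) (cnj (z_of r s t))"
    and "sigma_t r s t = - ln \<bar>1 - r\<^sup>2\<bar> + slope_potential (phase_sign r) (w_of r s t)"
    by (simp_all add: sigma_s_def sigma_t_def Let_def slope_potential_def phase_sign_def norm_mult)
qed

text \<open>Both sides are the form \<open>(1 - s) dlog v + s dlog (1 - v)\<close> on the tangent vector \<open>h\<close>: the right-hand side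
  shows its real and imaginary parts, the left-hand side is what enters the Burgers equation.\<close>

lemma slope_form_split:
  fixes v h :: complex
  assumes "v \<noteq> 0" "v \<noteq> 1"
  shows "h * ((1 - of_real s - v) / (v * (1 - v))) = of_real (1 - s) * (h / v) + of_real s * (- h / (1 - v))"
proof -
  have "1 - v \<noteq> 0" using assms by simp
  hence "of_real (1 - s) * (h / v) + of_real s * (- h / (1 - v))
      = (of_real (1 - s) * h * (1 - v) - of_real s * h * v) / (v * (1 - v))"
    using assms by (simp add: divide_simps)
  also have "of_real (1 - s) * h * (1 - v) - of_real s * h * v = h * (1 - of_real s - v)"
    by (simp add: algebra_simps)
  finally show ?thesis by simp
qed

text \<open>In the differential of \<open>B\<close> the coefficients \<open>Arg v\<close> and \<open>Arg (1 - v)\<close> become multiples of \<open>\<theta>\<close>. For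
  \<open>\<epsilon> = -1\<close> they carry an additional \<open>\<pi>\<close>, which the term \<open>log |v (1 - v)|\<close> in the surface tension
  compensates.\<close>

lemma slope_potential_has_derivative:
  assumes \<epsilon>: "\<epsilon> = 1 \<or> \<epsilon> = -1" and ang: "slope_angles \<epsilon> \<theta> s v"
  shows "(slope_potential \<epsilon> has_derivative
    (\<lambda>h. - (\<theta> / pi) * Re (h * ((1 - of_real s - v) / (v * (1 - v)))))) (at v)"
proof -
  have v: "Im v > 0" "Arg v = (1 - \<epsilon>) / 2 * pi + \<epsilon> * (s * \<theta>)"
    "Arg (1 - v) = - ((1 - \<epsilon>) / 2 * pi) - \<epsilon> * ((1 - s) * \<theta>)"
    using ang by (auto simp: slope_angles_def)
  have "((\<lambda>x. - \<epsilon> * B_fun x - (1 - \<epsilon>) / 2 * (ln (cmod x) + ln (cmod (1 - x)))) has_derivative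
      (\<lambda>h. - \<epsilon> * ((Arg v * Re (- h / (1 - v)) - Arg (1 - v) * Re (h / v)) / pi)
        - (1 - \<epsilon>) / 2 * (Re (h / v) + Re (- h / (1 - v))))) (at v)"
    using v(1) by (intro has_derivative_diff has_derivative_mult_right has_derivative_add
      B_fun_has_derivative ln_cmod_one_minus_has_derivative
      ln_cmod_has_derivative) auto
  moreover have "(\<lambda>h. - \<epsilon> * ((Arg v * Re (- h / (1 - v)) - Arg (1 - v) * Re (h / v)) / pi)
        - (1 - \<epsilon>) / 2 * (Re (h / v) + Re (- h / (1 - v))))
      = (\<lambda>h. - (\<theta> / pi) * Re (h * ((1 - of_real s - v) / (v * (1 - v)))))"
  proof
    fix h :: complex
    have "- \<epsilon> * ((Arg v * Q - Arg (1 - v) * P) / pi) - (1 - \<epsilon>) / 2 * (P + Q)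
      = - (\<theta> / pi) * ((1 - s) * P + s * Q)" for P Q :: real
      using \<epsilon> by (elim disjE) (simp_all add: v field_simps)
    moreover have "Re (h * ((1 - of_real s - v) / (v * (1 - v)))) = (1 - s) * Re (h / v) + s * Re (- h / (1 - v))"
    proof -
      have "v \<noteq> 0" "v \<noteq> 1" using v(1) by auto
      from slope_form_split[OF this, of h s] show ?thesis
        by (simp only: plus_complex.sel Re_complex_of_real Im_complex_of_real times_complex.sel mult_zero_left diff_zero)
    qed
    ultimately show "- \<epsilon> * ((Arg v * Re (- h / (1 - v)) - Arg (1 - v) * Re (h / v)) / pi)
        - (1 - \<epsilon>) / 2 * (Re (h / v) + Re (- h / (1 - v)))
      = - (\<theta> / pi) * Re (h * ((1 - of_real s - v) / (v * (1 - v))))" by metis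
  qed
  ultimately have d: "((\<lambda>x. - \<epsilon> * B_fun x - (1 - \<epsilon>) / 2 * (ln (cmod x) + ln (cmod (1 - x)))) has_derivative
    (\<lambda>h. - (\<theta> / pi) * Re (h * ((1 - of_real s - v) / (v * (1 - v)))))) (at v)"
    by (simp only:)
  show ?thesis
  proof (rule has_derivative_transform_within_open[OF d open_halfspace_Im_gt[of 0]])
    show "v \<in> {x. 0 < Im x}" using v by simp
    fix x :: complex assume "x \<in> {x. 0 < Im x}"
    hence "cmod x > 0" "cmod (1 - x) > 0" by auto
    thus "- \<epsilon> * B_fun x - (1 - \<epsilon>) / 2 * (ln (cmod x) + ln (cmod (1 - x))) = slope_potential \<epsilon> x"
      by (simp only: slope_potential_def norm_mult ln_mult_pos)
  qed
qed

text \<open>The combination \<open>(1 - s) Arg v + s Arg (1 - v)\<close> does not contain \<open>\<theta>\<close>: it equals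
  \<open>(1 - \<epsilon>) \<pi> / 2 (1 - 2 s)\<close>. Its differential therefore determines \<open>(1 - s) d Arg v + s d Arg (1 - v)\<close>,
  and \<open>\<theta>\<close> is never differentiated.\<close>

lemma slope_angles_Im:
  fixes v :: "'a::real_normed_vector \<Rightarrow> complex"
  assumes S: "open S" "p \<in> S" and ang: "\<And>q. q \<in> S \<Longrightarrow> slope_angles \<epsilon> (\<theta> q) (s q) (v q)"
    and v': "(v has_derivative v') (at p)" and s': "(s has_derivative s') (at p)"
  shows "Im (v' h * ((1 - of_real (s p) - v p) / (v p * (1 - v p)))) = \<epsilon> * \<theta> p * s' h"
proof -
  have p: "Im (v p) > 0" "Arg (v p) = (1 - \<epsilon>) / 2 * pi + \<epsilon> * (s p * \<theta> p)"
    "Arg (1 - v p) = - ((1 - \<epsilon>) / 2 * pi) - \<epsilon> * ((1 - s p) * \<theta> p)"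
    using ang[OF S(2)] by (auto simp: slope_angles_def)
  have "((\<lambda>q. 1 - v q) has_derivative (\<lambda>h. - v' h)) (at p)"
    using v' by (auto intro!: derivative_eq_intros)
  hence A: "((\<lambda>q. Arg (1 - v q)) has_derivative (\<lambda>h. Im (- v' h / (1 - v p)))) (at p)"
    by (rule has_derivative_compose[OF _ Arg_has_derivative]) (use p in simp)
  have B: "((\<lambda>q. Arg (v q)) has_derivative (\<lambda>h. Im (v' h / v p))) (at p)"
    using v' by (rule has_derivative_compose[OF _ Arg_has_derivative]) (use p in simp)
  have one: "((\<lambda>q. 1 - s q) has_derivative (\<lambda>h. - s' h)) (at p)"
    using s' by (auto intro!: derivative_eq_intros)
  have L: "((\<lambda>q. (1 - s q) * Arg (v q) + s q * Arg (1 - v q)) has_derivative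
      (\<lambda>h. ((1 - s p) * Im (v' h / v p) + - s' h * Arg (v p)) + (s p * Im (- v' h / (1 - v p)) + s' h * Arg (1 - v p)))) (at p)"
    by (intro has_derivative_add has_derivative_mult A B one s')
  have R: "((\<lambda>q. (1 - \<epsilon>) / 2 * pi * (1 - 2 * s q)) has_derivative (\<lambda>h. (1 - \<epsilon>) / 2 * pi * (- 2 * s' h))) (at p)"
    using s' by (auto intro!: derivative_eq_intros)
  have eq: "(1 - s q) * Arg (v q) + s q * Arg (1 - v q) = (1 - \<epsilon>) / 2 * pi * (1 - 2 * s q)" if "q \<in> S" for q
  proof -
    have "Arg (v q) = (1 - \<epsilon>) / 2 * pi + \<epsilon> * (s q * \<theta> q)"
      "Arg (1 - v q) = - ((1 - \<epsilon>) / 2 * pi) - \<epsilon> * ((1 - s q) * \<theta> q)"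
      using ang[OF that] by (auto simp: slope_angles_def)
    thus ?thesis by (simp only:) (simp add: field_simps)
  qed
  note has_derivative_transform_within_open[OF L S eq]
  from has_derivative_unique[OF this R]
  have "((1 - s p) * Im (v' h / v p) + - s' h * Arg (v p)) + (s p * Im (- v' h / (1 - v p)) + s' h * Arg (1 - v p))
      = (1 - \<epsilon>) / 2 * pi * (- 2 * s' h)" by (rule fun_cong)
  hence "(1 - s p) * Im (v' h / v p) + s p * Im (- v' h / (1 - v p)) = \<epsilon> * \<theta> p * s' h"
    by (simp only: p) (simp add: field_simps)
  moreover have "Im (v' h * ((1 - of_real (s p) - v p) / (v p * (1 - v p))))
      = (1 - s p) * Im (v' h / v p) + s p * Im (- v' h / (1 - v p))"
  proof -
    have "v p \<noteq> 0" "v p \<noteq> 1" using p(1) by auto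
    from slope_form_split[OF this, of "v' h" "s p"] show ?thesis
      by (simp only: plus_complex.sel Re_complex_of_real Im_complex_of_real times_complex.sel mult_zero_left add_0_right)
  qed
  ultimately show ?thesis by simp
qed

text \<open>In logarithmic form: \<open>dz / (z (1 - z)) = - dw / (w (1 - w))\<close>, because \<open>(1 - z) / z\<close> is a constant multiple
  of \<open>w / (1 - w)\<close>.\<close>

lemma mobius_has_derivative:
  fixes w z :: "'a::real_normed_vector \<Rightarrow> complex"
  assumes S: "open S" "p \<in> S"
    and rel: "\<And>q. q \<in> S \<Longrightarrow> 1 - w q - z q + c * w q * z q = 0" "\<And>q. q \<in> S \<Longrightarrow> c * w q \<noteq> 1"
    and w': "(w has_derivative w') (at p)" and nz: "w p \<noteq> 0" "w p \<noteq> 1"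
  shows "(z has_derivative (\<lambda>h. - (z p * (1 - z p)) / (w p * (1 - w p)) * w' h)) (at p)"
proof -
  have z_eq: "z = (w - 1) / (c * w - 1)" if "1 - w - z + c * w * z = 0" "c * w \<noteq> 1" for w z
    using that by (simp add: divide_simps) (simp add: algebra_simps)
  have p: "1 - w p - z p + c * w p * z p = 0" "c * w p \<noteq> 1"
    using rel S(2) by auto
  have "((\<lambda>x. (x - 1) / (c * x - 1)) has_field_derivative (c - 1) / (c * w p - 1)\<^sup>2) (at (w p))"
    using p by (auto intro!: derivative_eq_intros simp: power2_eq_square algebra_simps)
  moreover have "(c - 1) / (c * w p - 1)\<^sup>2 = - (z p * (1 - z p)) / (w p * (1 - w p))"
  proof -
    have nz': "c * w p - 1 \<noteq> 0" "1 - w p \<noteq> 0" using p nz by auto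
    have "1 - z p = (c - 1) * w p / (c * w p - 1)"
      unfolding z_eq[OF p] using nz' by (simp add: field_simps)
    hence "z p * (1 - z p) = (w p - 1) * ((c - 1) * w p) / (c * w p - 1)\<^sup>2"
      by (simp only: z_eq[OF p] times_divide_times_eq power2_eq_square)
    also have "(w p - 1) * ((c - 1) * w p) = - ((c - 1) * (w p * (1 - w p)))"
      by (simp add: algebra_simps)
    finally have "- (z p * (1 - z p)) = (c - 1) / (c * w p - 1)\<^sup>2 * (w p * (1 - w p))"
      by simp
    moreover have "w p * (1 - w p) \<noteq> 0" using nz nz' by simp
    ultimately show ?thesis by (metis nonzero_mult_div_cancel_right)
  qed
  ultimately have "((\<lambda>x. (x - 1) / (c * x - 1)) has_derivative (*) (- (z p * (1 - z p)) / (w p * (1 - w p)))) (at (w p))"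
    by (simp only: has_field_derivative_def)
  from has_derivative_compose[OF w' this]
  have "((\<lambda>q. (w q - 1) / (c * w q - 1)) has_derivative (\<lambda>h. - (z p * (1 - z p)) / (w p * (1 - w p)) * w' h)) (at p)" .
  thus ?thesis
    by (rule has_derivative_transform_within_open[OF _ S]) (simp add: z_eq[OF rel])
qed

section \<open>The complex Burgers equation and its integration\<close>

lemma linear_pair_split:
  fixes f :: "real \<times> real \<Rightarrow> 'a::real_vector"
  assumes "linear f"
  shows "f h = fst h *\<^sub>R f (1, 0) + snd h *\<^sub>R f (0, 1)"
proof -
  have "h = fst h *\<^sub>R (1, 0) + snd h *\<^sub>R (0, 1)" by (simp add: prod_eq_iff)
  hence "f h = f (fst h *\<^sub>R (1, 0) + snd h *\<^sub>R (0, 1))" by (rule arg_cong)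
  also have "\<dots> = fst h *\<^sub>R f (1, 0) + snd h *\<^sub>R f (0, 1)"
    by (simp only: linear_add[OF assms] linear_scale[OF assms])
  finally show ?thesis .
qed

text \<open>The complex Burgers equation \<open>(1 - s - w) w_y = (1 - t - z) w_x\<close>. With \<open>\<Omega> = dw / (w (1 - w))\<close> it
  becomes \<open>\<Omega>\<^sub>y P = \<Omega>\<^sub>x Q\<close>. The imaginary part is \<open>s_y = t_x\<close>, and the real part is the Euler-Lagrange
  equation; the common factor \<open>\<theta> > 0\<close> cancels in both.\<close>

lemma burgers_equation:
  fixes r :: real and H :: "real \<times> real \<Rightarrow> real"
  assumes r: "r > 0" "r \<noteq> 1" and D: "open D" and H: "C2_on D H"
    and slope: "\<forall>p\<in>D. (partial_x H p, partial_y H p) \<in> slope_region r"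
    and EL: "euler_lagrange_on r D H" and p: "p \<in> D"
    and w': "(w_field r H has_derivative w') (at p)"
  defines "P \<equiv> 1 - of_real (partial_x H p) - w_field r H p"
    and "Q \<equiv> 1 - of_real (partial_y H p) - z_field r H p"
    and "K \<equiv> - (z_field r H p * (1 - z_field r H p)) / (w_field r H p * (1 - w_field r H p))"
  shows "Im (w_field r H p) > 0"
    and "w' (0, 1) * P = w' (1, 0) * Q"
    and "(z_field r H has_derivative (\<lambda>h. K * w' h)) (at p)"
proof -
  define w where "w = w_field r H"
  define z where "z = z_field r H"
  define \<epsilon> where "\<epsilon> = phase_sign r"
  define s where "s = partial_x H"
  define t where "t = partial_y H"
  define C where "C = complex_of_real (1 - r\<^sup>2)"
  have \<epsilon>: "\<epsilon> = 1 \<or> \<epsilon> = -1" by (simp add: \<epsilon>_def phase_sign_def)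
  have "\<forall>q\<in>D. \<exists>\<theta>>0. slope_angles \<epsilon> \<theta> (s q) (w q) \<and> slope_angles \<epsilon> \<theta> (t q) (cnj (z q))"
    using slope_angles_w_z(1)[OF r] slope
    by (auto simp: \<epsilon>_def s_def t_def w_def z_def w_field_def z_field_def)
  then obtain \<theta> where \<theta>: "\<And>q. q \<in> D \<Longrightarrow> \<theta> q > 0"
    and ang_w: "\<And>q. q \<in> D \<Longrightarrow> slope_angles \<epsilon> (\<theta> q) (s q) (w q)"
    and ang_z: "\<And>q. q \<in> D \<Longrightarrow> slope_angles \<epsilon> (\<theta> q) (t q) (cnj (z q))"
    by metis
  have Im_w: "Im (w q) > 0" if "q \<in> D" for q using ang_w[OF that] by (simp add: slope_angles_def)
  show "Im (w_field r H p) > 0" using Im_w[OF p] by (simp add: w_def)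
  have rel: "1 - w q - z q + C * w q * z q = 0" if "q \<in> D" for q
    using slope_angles_w_z(2)[OF r] slope that
    by (auto simp: C_def w_def z_def w_field_def z_field_def)
  have Cw: "C * w q \<noteq> 1" if "q \<in> D" for q
  proof
    assume "C * w q = 1"
    hence "Im (C * w q) = 0" by simp
    moreover have "r\<^sup>2 \<noteq> 1" using r by (simp add: power2_eq_1_iff)
    ultimately show False using Im_w[OF that] by (simp add: C_def)
  qed
  have w0: "w p \<noteq> 0" "w p \<noteq> 1" using Im_w[OF p] by auto
  have z0: "z p \<noteq> 0" "z p \<noteq> 1" using ang_z[OF p] by (auto simp: slope_angles_def)
  have w'': "(w has_derivative w') (at p)" using w' by (simp add: w_def)
  have z': "(z has_derivative (\<lambda>h. K * w' h)) (at p)"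
    using mobius_has_derivative[OF D p rel Cw w'' w0] by (simp add: K_def w_def z_def)
  thus "(z_field r H has_derivative (\<lambda>h. K * w' h)) (at p)" by (simp add: z_def)
  define \<Omega> where "\<Omega> = (\<lambda>h. w' h / (w p * (1 - w p)))"
  have \<Omega>_w: "w' h * ((1 - of_real (s p) - w p) / (w p * (1 - w p))) = \<Omega> h * P" for h
    by (simp add: \<Omega>_def P_def s_def w_def)
  have \<Omega>_z: "cnj (K * w' h) * ((1 - of_real (t p) - cnj (z p)) / (cnj (z p) * (1 - cnj (z p))))
      = - cnj (\<Omega> h * Q)" for h
  proof -
    have "K * w' h * ((1 - of_real (t p) - z p) / (z p * (1 - z p))) = - (\<Omega> h * Q)"
      using z0 by (simp add: K_def \<Omega>_def Q_def t_def w_def[symmetric] z_def[symmetric])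
    from arg_cong[OF this, of cnj] show ?thesis by simp
  qed
  have dz: "((\<lambda>q. cnj (z q)) has_derivative (\<lambda>h. cnj (K * w' h))) (at p)"
    using z' by (rule has_derivative_cnj)
  obtain s' where s': "(s has_derivative s') (at p)"
    using H p by (auto simp: s_def C2_on_def C1_on_def differentiable_def)
  obtain t' where t': "(t has_derivative t') (at p)"
    using H p by (auto simp: t_def C2_on_def C1_on_def differentiable_def)
  have sym: "s' (0, 1) = t' (1, 0)"
  proof -
    have "\<And>q. q \<in> D \<Longrightarrow> H differentiable (at q)" using H by (auto simp: C2_on_def C1_on_def)
    with mixed_partials_commute[of D "fst p" "snd p" H s' t'] D p s' t'
    show ?thesis by (simp add: s_def t_def)
  qed
  have Im_eq: "Im (\<Omega> (0, 1) * P) = Im (\<Omega> (1, 0) * Q)"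
  proof -
    have "Im (\<Omega> (0, 1) * P) = \<epsilon> * \<theta> p * s' (0, 1)"
      using slope_angles_Im[OF D p ang_w w'' s', of "(0, 1)"] by (simp only: \<Omega>_w)
    moreover have "Im (- cnj (\<Omega> (1, 0) * Q)) = \<epsilon> * \<theta> p * t' (1, 0)"
      using slope_angles_Im[OF D p ang_z dz t', of "(1, 0)"] by (simp only: \<Omega>_z)
    ultimately show ?thesis using sym by simp
  qed
  have Re_eq: "Re (\<Omega> (0, 1) * P) = Re (\<Omega> (1, 0) * Q)"
  proof -
    obtain x y where xy: "p = (x, y)" by (cases p)
    obtain a b where
      a: "((\<lambda>x'. sigma_s r (s (x', y)) (t (x', y))) has_real_derivative a) (at x)" and
      b: "((\<lambda>y'. sigma_t r (s (x, y')) (t (x, y'))) has_real_derivative b) (at y)" and "a + b = 0"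
      using EL p xy by (force simp: euler_lagrange_on_def s_def t_def)
    have "((\<lambda>q. sigma_s r (s q) (t q)) has_derivative (\<lambda>h. - (\<theta> p / pi) * Re (- cnj (\<Omega> h * Q)))) (at (x, y))"
    proof -
      have "((\<lambda>q. - ln \<bar>1 - r\<^sup>2\<bar> + slope_potential \<epsilon> (cnj (z q))) has_derivative
          (\<lambda>h. 0 + - (\<theta> p / pi) * Re (- cnj (\<Omega> h * Q)))) (at p)"
        using has_derivative_compose[OF dz slope_potential_has_derivative[OF \<epsilon> ang_z[OF p]]]
        by (intro has_derivative_add has_derivative_const) (simp only: \<Omega>_z)
      thus ?thesis
        by (simp add: sigma_eq_slope_potential[OF r(1)] xy \<epsilon>_def z_def s_def t_def z_field_def)
    qed
    from has_derivative_partial_x(1)[OF this] have a': "a = - (\<theta> p / pi) * Re (- cnj (\<Omega> (1, 0) * Q))"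
      by (rule DERIV_unique[OF a])
    have "((\<lambda>q. sigma_t r (s q) (t q)) has_derivative (\<lambda>h. - (\<theta> p / pi) * Re (\<Omega> h * P))) (at (x, y))"
    proof -
      have "((\<lambda>q. - ln \<bar>1 - r\<^sup>2\<bar> + slope_potential \<epsilon> (w q)) has_derivative
          (\<lambda>h. 0 + - (\<theta> p / pi) * Re (\<Omega> h * P))) (at p)"
        using has_derivative_compose[OF w'' slope_potential_has_derivative[OF \<epsilon> ang_w[OF p]]]
        by (intro has_derivative_add has_derivative_const) (simp only: \<Omega>_w)
      thus ?thesis
        by (simp add: sigma_eq_slope_potential[OF r(1)] xy \<epsilon>_def w_def s_def t_def w_field_def)
    qed
    from has_derivative_partial_y(1)[OF this] have b': "b = - (\<theta> p / pi) * Re (\<Omega> (0, 1) * P)"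
      by (rule DERIV_unique[OF b])
    have "\<theta> p / pi * (Re (\<Omega> (1, 0) * Q) - Re (\<Omega> (0, 1) * P)) = a + b"
      unfolding a' b' by (simp add: right_diff_distrib)
    thus ?thesis using \<open>a + b = 0\<close> \<theta>[OF p] by simp
  qed
  have "\<Omega> (0, 1) * P = \<Omega> (1, 0) * Q"
    using Re_eq Im_eq by (simp only: complex_eq_iff)
  thus "w' (0, 1) * P = w' (1, 0) * Q"
    using w0 by (simp add: \<Omega>_def)
qed

theorem theorem8p3:
  fixes r :: real and D :: "(real \<times> real) set" and H :: "real \<times> real \<Rightarrow> real"
  assumes "r > 0" and "r \<noteq> 1"
    and "open D"
    and "C2_on D H"
    and "\<forall>p\<in>D. (partial_x H p, partial_y H p) \<in> slope_region r"
    and "euler_lagrange_on r D H"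
  shows "\<forall>U. open U \<and> U \<subseteq> D \<and> coordinate_on U (w_field r H) \<longrightarrow>
    (\<exists>f. f analytic_on (w_field r H ` U) \<and>
      (\<forall>(x, y)\<in>U. (w_field r H (x, y) - 1) * of_real x + (z_field r H (x, y) - 1) * of_real y
         + of_real (H (x, y)) + f (w_field r H (x, y)) = 0))"
proof (intro allI impI)
  fix U assume U: "open U \<and> U \<subseteq> D \<and> coordinate_on U (w_field r H)"
  define w where "w = w_field r H"
  define z where "z = z_field r H"
  define F where "F = (\<lambda>p. - ((w p - 1) * of_real (fst p) + (z p - 1) * of_real (snd p) + of_real (H p)))"
  have "\<exists>w' c. (w has_derivative w') (at p) \<and> bij w' \<and> (F has_derivative (\<lambda>h. c * w' h)) (at p)"
    if p: "p \<in> U" for p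
  proof -
    obtain w' where w': "(w has_derivative w') (at p)" and bij: "bij w'"
      using U p by (auto simp: coordinate_on_def w_def)
    have pD: "p \<in> D" using U p by auto
    define s where "s = partial_x H p"
    define t where "t = partial_y H p"
    define P where "P = 1 - of_real s - w p"
    define Q where "Q = 1 - of_real t - z p"
    define K where "K = - (z p * (1 - z p)) / (w p * (1 - w p))"
    note burgers = burgers_equation[OF assms pD, of w',
        folded w_def z_def, OF w', folded s_def t_def, folded P_def Q_def K_def]
    have lin: "linear w'" using w' by (rule has_derivative_linear)
    have "w' (1, 0) \<noteq> w' 0" using bij by (metis bij_is_inj inj_eq zero_prod_def prod.inject zero_neq_one)
    hence w1: "w' (1, 0) \<noteq> 0" using linear_0[OF lin] by simp
    obtain H' where H': "(H has_derivative H') (at p)"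
      using assms(4) pD by (auto simp: C2_on_def C1_on_def differentiable_def)
    have "H' (1, 0) = s" "H' (0, 1) = t"
      using has_derivative_partial_x(2)[of H H' "fst p" "snd p"]
        has_derivative_partial_y(2)[of H H' "fst p" "snd p"] H' by (simp_all add: s_def t_def)
    with linear_pair_split[OF has_derivative_linear[OF H']]
    have H'_eq: "H' h = fst h * s + snd h * t" for h by simp
    \<comment> \<open>The last term of \<open>c\<close> comes from \<open>P dx + Q dy = (P / w_x) dw\<close>, a form of the Burgers equation.\<close>
    define c where "c = - (of_real (fst p) + K * of_real (snd p) - P / w' (1, 0))"
    have "(F has_derivative (\<lambda>h. - (((w p - 1) * of_real (fst h) + w' h * of_real (fst p))
        + ((z p - 1) * of_real (snd h) + K * w' h * of_real (snd p)) + of_real (H' h)))) (at p)"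
      unfolding F_def using w' burgers(3) H'
      by (intro has_derivative_minus has_derivative_add has_derivative_mult has_derivative_of_real
        has_derivative_fst has_derivative_snd has_derivative_ident) (auto intro!: derivative_eq_intros)
    moreover have "- (((w p - 1) * of_real (fst h) + w' h * of_real (fst p))
        + ((z p - 1) * of_real (snd h) + K * w' h * of_real (snd p)) + of_real (H' h)) = c * w' h" for h
    proof -
      have "P * w' h = of_real (fst h) * w' (1, 0) * P + of_real (snd h) * (w' (0, 1) * P)"
        by (subst linear_pair_split[OF lin]) (simp add: scaleR_conv_of_real algebra_simps)
      also have "\<dots> = w' (1, 0) * (of_real (fst h) * P + of_real (snd h) * Q)"
        unfolding burgers(2) by (simp add: algebra_simps)
      finally have "P / w' (1, 0) * w' h = of_real (fst h) * P + of_real (snd h) * Q"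
        using w1 by (simp add: field_simps)
      thus ?thesis
        by (simp add: c_def H'_eq P_def Q_def algebra_simps)
    qed
    ultimately show ?thesis using w' bij by auto
  qed
  from holomorphic_factor[of U w F, OF _ _ this] U
  obtain f where "f analytic_on w ` U" "\<forall>p\<in>U. f (w p) = F p"
    by (auto simp: coordinate_on_def w_def)
  thus "\<exists>f. f analytic_on (w_field r H ` U) \<and>
      (\<forall>(x, y)\<in>U. (w_field r H (x, y) - 1) * of_real x + (z_field r H (x, y) - 1) * of_real y
         + of_real (H (x, y)) + f (w_field r H (x, y)) = 0)"
    by (intro exI[of _ f]) (auto simp: F_def w_def z_def)
qed

end
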